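(* Let $\mathcal X\subseteq\mathbb R^n$ be a nonempty compact convex set and $\mathcal Y\subseteq\mathbb R^d$ a nonempty closed convex set, let $f:\mathbb R^n\times\mathbb R^d\to\mathbb R$ be continuously differentiable with $L$-Lipschitz partial gradients on $\mathcal X\times\mathcal Y$ (in the sense of the context, $L\ge1$), and consider the problem $\min_{x\in\mathcal X}\max_{y\in\mathcal Y}f(x,y)$. For any integer $T>1$, one can select parameters $0<r_x,r_y,\eta_x,\eta_y,\beta_x,\beta_y=\mathcal O(1)$ for the DS-OGDA algorithm such that there exists an index $t\in\{0,1,\dots,T-1\}$ for which the following hold: (i) (Convex primal) Suppose $f(\cdot,y)$ is convex for all $y\in\mathcal Y$. If $\min_{x\in\mathcal X}f(x,\cdot)$ is bounded above on $\mathcal Y$ and $\beta_y\le\mathcal O(T^{-1/2})$, then $(x^{t+1},y^{t+1})$ is an $\mathcal O(T^{-1/4})$-game stationary point of the problem. (ii) (KŁ property) Suppose the primal KŁ property (see context) holds with exponent $\theta\in(0,1)$. If $\mathcal Y$ is compact and $\beta_y\le\mathcal O\big(T^{-(2\theta-1)_+/(2\theta)}\big)$, then $(x^{t+1},y^{t+1})$ is an $\mathcal O\big(T^{-1/((4\theta-2)_++2)}\big)$-game stationary point of the problem.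
   Context: Norms are Euclidean, $a_+=\max\{a,0\}$. $\iota_{\mathcal X}$ is the indicator function of $\mathcal X$ ($0$ on $\mathcal X$, $+\infty$ elsewhere), and $\partial\iota_{\mathcal X}(x)$ is the normal cone. $\mathrm{dist}$ is Euclidean distance to a set, $\mathrm{proj}$ Euclidean projection. The notation $\mathcal O(\cdot)$ hides constants independent of $T$. Smoothness: for all $x,x'\in\mathcal X$, $y,y'\in\mathcal Y$, both $\|\nabla_xf(x,y)-\nabla_xf(x',y')\|$ and $\|\nabla_yf(x,y)-\nabla_yf(x',y')\|$ are at most $L(\|x-x'\|+\|y-y'\|)$. Primal KŁ property: for all $y\in\mathcal Y$, $\min_{x\in\mathcal X}f(x,y)$ has a nonempty solution set and finite optimal value, and there are $\tau_x>0$, $\theta\in(0,1)$ with $\big(f(x,y)-\min_{x'\in\mathcal X}f(x',y)\big)^\theta\le\frac1{\tau_x}\mathrm{dist}(0,\nabla_xf(x,y)+\partial\iota_{\mathcal X}(x))$ for all $x\in\mathcal X,y\in\mathcal Y$. DS-OGDA. Let $F(x,y,z,v)=f(x,y)+\frac{r_x}2\|x-z\|^2-\frac{r_y}2\|y-v\|^2$, $G_x=\nabla_xF$, $G_y=-\nabla_yF$, and let $G_x^t,G_y^t$ be their values at $(x^t,y^t,z^t,v^t)$. Starting from $x^0\in\mathcal X$, $y^0\in\mathcal Y$ with $x^{-1}=x^0$, $y^{-1}=y^0$, $z^{-1}=z^0=x^0$, $v^{-1}=v^0=y^0$, step sizes $\eta_x,\eta_y>0$ and $0<\beta_x,\beta_y<1$,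 for $t=0,1,2,\dots$: $x^{t+1}=\mathrm{proj}_{\mathcal X}(x^t-\eta_xG_x^t+\eta_x(G_x^{t-1}-G_x^t))$, $y^{t+1}=\mathrm{proj}_{\mathcal Y}(y^t-\eta_yG_y^t+\eta_y(G_y^{t-1}-G_y^t))$, $z^{t+1}=z^t+\beta_x(x^t-z^t)$, $v^{t+1}=v^t+\beta_y(y^t-v^t)$. $(x,y)\in\mathcal X\times\mathcal Y$ is an $\epsilon$-game stationary point if $\mathrm{dist}(0,\nabla_xf(x,y)+\partial\iota_{\mathcal X}(x))\le\epsilon$ and $\mathrm{dist}(0,-\nabla_yf(x,y)+\partial\iota_{\mathcal Y}(y))\le\epsilon$. *)

theory Defs
  imports "HOL-Analysis.Analysis"
begin

definition grad :: "('a::real_inner \<Rightarrow> real) \<Rightarrow> 'a \<Rightarrow> 'a" where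
  "grad g x = (THE D. GDERIV g x :> D)"

definition continuously_differentiable :: "('a::real_inner \<Rightarrow> real) \<Rightarrow> bool" where
  "continuously_differentiable g \<longleftrightarrow>
     (\<forall>x. g differentiable (at x)) \<and> continuous_on UNIV (grad g)"

definition grad_x :: "('a::real_inner \<Rightarrow> 'b::real_inner \<Rightarrow> real) \<Rightarrow> 'a \<Rightarrow> 'b \<Rightarrow> 'a" where
  "grad_x f x y = grad (\<lambda>u. f u y) x"

definition grad_y :: "('a::real_inner \<Rightarrow> 'b::real_inner \<Rightarrow> real) \<Rightarrow> 'a \<Rightarrow> 'b \<Rightarrow> 'b" where
  "grad_y f x y = grad (\<lambda>w. f x w) y"

definition lipschitz_partial_gradients ::
  "('a::real_inner \<Rightarrow> 'b::real_inner \<Rightarrow> real) \<Rightarrow> 'a set \<Rightarrow> 'b set \<Rightarrow> real \<Rightarrow> bool" where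
  "lipschitz_partial_gradients f X Y L \<longleftrightarrow>
     (\<forall>x\<in>X. \<forall>x'\<in>X. \<forall>y\<in>Y. \<forall>y'\<in>Y.
        norm (grad_x f x y - grad_x f x' y') \<le> L * (norm (x - x') + norm (y - y')) \<and>
        norm (grad_y f x y - grad_y f x' y') \<le> L * (norm (x - x') + norm (y - y')))"

text \<open>The subdifferential of the indicator function of \<open>S\<close> at a point \<open>x\<close> of \<open>S\<close>;
  it is only used at such points.\<close>

definition normal_cone :: "'a::real_inner set \<Rightarrow> 'a \<Rightarrow> 'a set" where
  "normal_cone S x = {n. \<forall>u\<in>S. n \<bullet> (u - x) \<le> 0}"

definition min_x :: "('a \<Rightarrow> 'b \<Rightarrow> real) \<Rightarrow> 'a set \<Rightarrow> 'b \<Rightarrow> real" where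
  "min_x f X y = (INF x\<in>X. f x y)"

text \<open>In the first conjunct, attainment makes the minimum a real number, so that the
  infimum in \<^const>\<open>min_x\<close> is this minimum.\<close>

definition primal_KL ::
  "('a::euclidean_space \<Rightarrow> 'b::euclidean_space \<Rightarrow> real) \<Rightarrow> 'a set \<Rightarrow> 'b set \<Rightarrow> real \<Rightarrow> bool" where
  "primal_KL f X Y \<theta> \<longleftrightarrow>
     (\<forall>y\<in>Y. \<exists>x\<in>X. \<forall>x'\<in>X. f x y \<le> f x' y) \<and>
     (\<exists>\<tau>>0. \<forall>x\<in>X. \<forall>y\<in>Y.
        (f x y - min_x f X y) powr \<theta>
          \<le> (1 / \<tau>) * infdist 0 ((\<lambda>n. grad_x f x y + n) ` normal_cone X x))"

definition game_stationary ::
  "('a::euclidean_space \<Rightarrow> 'b::euclidean_space \<Rightarrow> real) \<Rightarrow> 'a set \<Rightarrow> 'b set \<Rightarrow> real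
     \<Rightarrow> 'a \<Rightarrow> 'b \<Rightarrow> bool" where
  "game_stationary f X Y \<epsilon> x y \<longleftrightarrow>
     x \<in> X \<and> y \<in> Y \<and>
     infdist 0 ((\<lambda>n. grad_x f x y + n) ` normal_cone X x) \<le> \<epsilon> \<and>
     infdist 0 ((\<lambda>n. - grad_y f x y + n) ` normal_cone Y y) \<le> \<epsilon>"

definition smoothed ::
  "('a::real_inner \<Rightarrow> 'b::real_inner \<Rightarrow> real) \<Rightarrow> real \<Rightarrow> real \<Rightarrow> 'a \<Rightarrow> 'b \<Rightarrow> 'a \<Rightarrow> 'b \<Rightarrow> real" where
  "smoothed f r\<^sub>x r\<^sub>y x y z v =
     f x y + (r\<^sub>x / 2) * (norm (x - z))\<^sup>2 - (r\<^sub>y / 2) * (norm (y - v))\<^sup>2"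

definition G_x ::
  "('a::real_inner \<Rightarrow> 'b::real_inner \<Rightarrow> real) \<Rightarrow> real \<Rightarrow> real \<Rightarrow> 'a \<times> 'b \<times> 'a \<times> 'b \<Rightarrow> 'a" where
  "G_x f r\<^sub>x r\<^sub>y = (\<lambda>(x, y, z, v). grad (\<lambda>u. smoothed f r\<^sub>x r\<^sub>y u y z v) x)"

definition G_y ::
  "('a::real_inner \<Rightarrow> 'b::real_inner \<Rightarrow> real) \<Rightarrow> real \<Rightarrow> real \<Rightarrow> 'a \<times> 'b \<times> 'a \<times> 'b \<Rightarrow> 'b" where
  "G_y f r\<^sub>x r\<^sub>y = (\<lambda>(x, y, z, v). - grad (\<lambda>w. smoothed f r\<^sub>x r\<^sub>y x w z v) y)"

text \<open>A state is a quadruple \<open>(x, y, z, v)\<close>. One step maps the states at times \<open>t - 1\<close> (\<open>p\<close>)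
  and \<open>t\<close> (\<open>s\<close>) to the state at time \<open>t + 1\<close>.\<close>

definition dsogda_step ::
  "('a::euclidean_space \<Rightarrow> 'b::euclidean_space \<Rightarrow> real) \<Rightarrow> 'a set \<Rightarrow> 'b set
     \<Rightarrow> real \<Rightarrow> real \<Rightarrow> real \<Rightarrow> real \<Rightarrow> real \<Rightarrow> real
     \<Rightarrow> 'a \<times> 'b \<times> 'a \<times> 'b \<Rightarrow> 'a \<times> 'b \<times> 'a \<times> 'b \<Rightarrow> 'a \<times> 'b \<times> 'a \<times> 'b" where
  "dsogda_step f X Y r\<^sub>x r\<^sub>y \<eta>\<^sub>x \<eta>\<^sub>y \<beta>\<^sub>x \<beta>\<^sub>y p s =
     (case s of (x, y, z, v) \<Rightarrow>
        (closest_point X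
           (x - \<eta>\<^sub>x *\<^sub>R G_x f r\<^sub>x r\<^sub>y s + \<eta>\<^sub>x *\<^sub>R (G_x f r\<^sub>x r\<^sub>y p - G_x f r\<^sub>x r\<^sub>y s)),
         closest_point Y
           (y - \<eta>\<^sub>y *\<^sub>R G_y f r\<^sub>x r\<^sub>y s + \<eta>\<^sub>y *\<^sub>R (G_y f r\<^sub>x r\<^sub>y p - G_y f r\<^sub>x r\<^sub>y s)),
         z + \<beta>\<^sub>x *\<^sub>R (x - z),
         v + \<beta>\<^sub>y *\<^sub>R (y - v)))"

text \<open>The pair of the states at times \<open>t - 1\<close> and \<open>t\<close>; the states at times \<open>-1\<close> and \<open>0\<close> coincide.\<close>

primrec dsogda_pair ::
  "('a::euclidean_space \<Rightarrow> 'b::euclidean_space \<Rightarrow> real) \<Rightarrow> 'a set \<Rightarrow> 'b set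
     \<Rightarrow> real \<Rightarrow> real \<Rightarrow> real \<Rightarrow> real \<Rightarrow> real \<Rightarrow> real \<Rightarrow> 'a \<Rightarrow> 'b \<Rightarrow> nat
     \<Rightarrow> ('a \<times> 'b \<times> 'a \<times> 'b) \<times> ('a \<times> 'b \<times> 'a \<times> 'b)" where
  "dsogda_pair f X Y r\<^sub>x r\<^sub>y \<eta>\<^sub>x \<eta>\<^sub>y \<beta>\<^sub>x \<beta>\<^sub>y x\<^sub>0 y\<^sub>0 0 = ((x\<^sub>0, y\<^sub>0, x\<^sub>0, y\<^sub>0), (x\<^sub>0, y\<^sub>0, x\<^sub>0, y\<^sub>0))"
| "dsogda_pair f X Y r\<^sub>x r\<^sub>y \<eta>\<^sub>x \<eta>\<^sub>y \<beta>\<^sub>x \<beta>\<^sub>y x\<^sub>0 y\<^sub>0 (Suc t) =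
     (case dsogda_pair f X Y r\<^sub>x r\<^sub>y \<eta>\<^sub>x \<eta>\<^sub>y \<beta>\<^sub>x \<beta>\<^sub>y x\<^sub>0 y\<^sub>0 t of (p, s) \<Rightarrow>
        (s, dsogda_step f X Y r\<^sub>x r\<^sub>y \<eta>\<^sub>x \<eta>\<^sub>y \<beta>\<^sub>x \<beta>\<^sub>y p s))"

definition dsogda_x where
  "dsogda_x f X Y r\<^sub>x r\<^sub>y \<eta>\<^sub>x \<eta>\<^sub>y \<beta>\<^sub>x \<beta>\<^sub>y x\<^sub>0 y\<^sub>0 t =
     fst (snd (dsogda_pair f X Y r\<^sub>x r\<^sub>y \<eta>\<^sub>x \<eta>\<^sub>y \<beta>\<^sub>x \<beta>\<^sub>y x\<^sub>0 y\<^sub>0 t))"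

definition dsogda_y where
  "dsogda_y f X Y r\<^sub>x r\<^sub>y \<eta>\<^sub>x \<eta>\<^sub>y \<beta>\<^sub>x \<beta>\<^sub>y x\<^sub>0 y\<^sub>0 t =
     fst (snd (snd (dsogda_pair f X Y r\<^sub>x r\<^sub>y \<eta>\<^sub>x \<eta>\<^sub>y \<beta>\<^sub>x \<beta>\<^sub>y x\<^sub>0 y\<^sub>0 t)))"

end

theory Submission
  imports Defs
begin

text \<open>With \<open>r\<^sub>x = r\<^sub>y = 4L\<close> the smoothed problem is strongly convex-strongly concave for frozen \<open>(z, v)\<close>,
  so one optimistic step contracts the iterate towards the saddle point of the smoothed problem, up to
  the slow drift of \<open>(z, v)\<close>. The remaining dynamics in \<open>(z, v)\<close> is a two-time-scale descent-ascent on the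
  saddle value \<open>P(z, v)\<close>, compared with \<open>D(v) = max\<^sub>y (min\<^sub>x f(x, y) - r\<^sub>y/2 |y - v|\<^sup>2) \<le> P(z, v)\<close>. Since
  \<open>y \<mapsto> min\<^sub>x f(x, y) - r\<^sub>y/2 |y - v|\<^sup>2\<close> is strongly concave, the squared distance from the \<open>y\<close>-part of the
  saddle point to its maximizer is at most a constant times a duality gap, which the KL inequality bounds
  by \<open>|x - z|\<^sup>p\<close> with \<open>p = min 2 (1/\<theta>)\<close>. For \<open>\<beta>\<^sub>y\<close> of order \<open>T powr - (1 - p / 2)\<close> the potential \<open>P - 2D\<close>, plus a
  multiple of the tracking error, therefore decreases up to \<open>O(1/T)\<close> per step. A convex primal
  satisfies the KL inequality with \<open>\<theta> = 1\<close>, by compactness of \<open>X\<close>.\<close>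

section \<open>Gradients, variational inequalities and the optimistic step\<close>

text \<open>The derivative is a linear functional, represented in the orthonormal basis by
  \<open>D\<close>; a representing vector is unique, so the definite description in
  \<open>grad\<close> denotes it.\<close>

lemma GDERIV_grad:
  fixes g :: "'a::euclidean_space \<Rightarrow> real"
  assumes "g differentiable (at x)"
  shows "GDERIV g x :> grad g x"
proof -
  obtain g' where g': "(g has_derivative g') (at x)"
    using assms by (auto simp: differentiable_def)
  then interpret bounded_linear g'
    by (rule has_derivative_bounded_linear)
  define D where "D = (\<Sum>b\<in>Basis. g' b *\<^sub>R b)"
  have "g' h = h \<bullet> D" for h
  proof -
    have "g' h = g' (\<Sum>b\<in>Basis. (h \<bullet> b) *\<^sub>R b)"
      by (simp add: euclidean_representation)
    also have "\<dots> = h \<bullet> D"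
      by (simp add: D_def sum scaleR inner_sum_right mult.commute)
    finally show ?thesis .
  qed
  then have D: "GDERIV g x :> D"
    using g' unfolding gderiv_def by (metis (no_types, lifting) ext)
  have "D' = D" if "GDERIV g x :> D'" for D'
  proof -
    have "(\<lambda>h. h \<bullet> D') = (\<lambda>h. h \<bullet> D)"
      using that D unfolding gderiv_def by (rule has_derivative_unique)
    then show ?thesis
      by (metis vector_eq_rdot inner_commute)
  qed
  then show ?thesis
    unfolding grad_def using D by (metis theI)
qed

lemma grad_eqI:
  fixes g :: "'a::euclidean_space \<Rightarrow> real"
  assumes "GDERIV g x :> D"
  shows "grad g x = D"
proof -
  have "g differentiable (at x)"
    using assms unfolding gderiv_def by (auto simp: differentiable_def)
  then have "GDERIV g x :> grad g x"
    by (rule GDERIV_grad)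
  then have "(\<lambda>h. h \<bullet> grad g x) = (\<lambda>h. h \<bullet> D)"
    using assms unfolding gderiv_def by (rule has_derivative_unique)
  then show ?thesis
    by (metis vector_eq_rdot inner_commute)
qed

lemma GDERIV_half_norm_square:
  fixes x z :: "'a::real_inner"
  shows "GDERIV (\<lambda>u. r / 2 * (norm (u - z))\<^sup>2) x :> r *\<^sub>R (x - z)"
  unfolding gderiv_def power2_norm_eq_inner
  by (auto intro!: derivative_eq_intros simp: inner_commute algebra_simps inner_diff_right)

lemma GDERIV_along_line:
  assumes "GDERIV g (x + t *\<^sub>R d) :> D"
  shows "((\<lambda>t. g (x + t *\<^sub>R d)) has_real_derivative d \<bullet> D) (at t)"
proof -
  have "((\<lambda>t. x + t *\<^sub>R d) has_derivative (\<lambda>s. s *\<^sub>R d)) (at t)"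
    by (auto intro!: derivative_eq_intros)
  moreover have "(g has_derivative (\<lambda>h. h \<bullet> D)) (at (x + t *\<^sub>R d))"
    using assms by (simp add: gderiv_def)
  ultimately have "((\<lambda>t. g (x + t *\<^sub>R d)) has_derivative (\<lambda>s. (s *\<^sub>R d) \<bullet> D)) (at t)"
    by (rule has_derivative_compose)
  then show ?thesis
    unfolding has_field_derivative_def by (simp add: mult_commute_abs)
qed

text \<open>One half of the descent lemma. Along the segment, \<open>g\<close> minus its
  linearization plus the quadratic is nondecreasing, since Cauchy-Schwarz and the Lipschitz bound
  relative to \<open>x\<close> make its derivative nonnegative.\<close>

lemma lipschitz_gradient_lower_bound:
  fixes g :: "'a::real_inner \<Rightarrow> real"
  assumes "convex S" and x: "x \<in> S" and y: "y \<in> S"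
    and deriv: "\<And>u. u \<in> S \<Longrightarrow> GDERIV g u :> g' u"
    and lip: "\<And>u. u \<in> S \<Longrightarrow> norm (g' u - g' x) \<le> L * norm (u - x)"
  shows "g y \<ge> g x + g' x \<bullet> (y - x) - L / 2 * (norm (y - x))\<^sup>2"
proof -
  define d where "d = y - x"
  define h where "h t = g (x + t *\<^sub>R d) - t * (d \<bullet> g' x) + L / 2 * t\<^sup>2 * (norm d)\<^sup>2" for t
  have "h 0 \<le> h 1"
  proof (rule DERIV_nonneg_imp_nondecreasing[of 0 1])
    fix t :: real
    assume t: "0 \<le> t" "t \<le> 1"
    have "x + t *\<^sub>R d = (1 - t) *\<^sub>R x + t *\<^sub>R y"
      by (simp add: d_def algebra_simps)
    then have S: "x + t *\<^sub>R d \<in> S"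
      using \<open>convex S\<close> x y t by (simp add: convexD)
    have "(h has_real_derivative d \<bullet> g' (x + t *\<^sub>R d) - d \<bullet> g' x + L * t * (norm d)\<^sup>2) (at t)"
      unfolding h_def
      by (rule derivative_eq_intros GDERIV_along_line[OF deriv[OF S]] refl | simp)+
    moreover have "- (d \<bullet> (g' (x + t *\<^sub>R d) - g' x)) \<le> L * t * (norm d)\<^sup>2"
    proof -
      have "- (d \<bullet> (g' (x + t *\<^sub>R d) - g' x)) \<le> norm d * norm (g' (x + t *\<^sub>R d) - g' x)"
        using Cauchy_Schwarz_ineq2[of d "g' (x + t *\<^sub>R d) - g' x"] by linarith
      also have "\<dots> \<le> norm d * (L * (t * norm d))"
        using lip[OF S] t by (intro mult_left_mono) auto
      finally show ?thesis
        by (simp add: power2_eq_square mult_ac)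
    qed
    ultimately show "\<exists>y. (h has_real_derivative y) (at t) \<and> 0 \<le> y"
      by (intro exI[of _ "d \<bullet> g' (x + t *\<^sub>R d) - d \<bullet> g' x + L * t * (norm d)\<^sup>2"])
        (simp add: inner_diff_right)
  qed simp
  then show ?thesis
    by (simp add: h_def d_def inner_commute)
qed

text \<open>Convexity bounds the difference quotient at every \<open>t\<close> in (0, 1) by
  \<open>g y - g x\<close>; its limit from the right is the directional derivative.\<close>

lemma convex_on_gradient_inequality:
  fixes g :: "'a::real_inner \<Rightarrow> real"
  assumes conv: "convex_on S g" and x: "x \<in> S" and y: "y \<in> S"
    and deriv: "GDERIV g x :> D"
  shows "g y \<ge> g x + D \<bullet> (y - x)"
proof -
  define d where "d = y - x"
  have "((\<lambda>t. g (x + t *\<^sub>R d)) has_real_derivative d \<bullet> D) (at 0)"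
    by (rule GDERIV_along_line) (use deriv in simp)
  then have "((\<lambda>t. (g (x + t *\<^sub>R d) - g x) / t) \<longlongrightarrow> d \<bullet> D) (at_right 0)"
    by (auto simp: DERIV_def intro: tendsto_within_subset)
  moreover have "\<forall>\<^sub>F t in at_right 0. (g (x + t *\<^sub>R d) - g x) / t \<le> g y - g x"
    unfolding eventually_at_right_field
  proof (intro exI[of _ 1] conjI allI impI)
    fix t :: real
    assume t: "0 < t" "t < 1"
    have "x + t *\<^sub>R d = (1 - t) *\<^sub>R x + t *\<^sub>R y"
      by (simp add: d_def algebra_simps)
    then have "g (x + t *\<^sub>R d) \<le> (1 - t) * g x + t * g y"
      using convex_onD[OF conv, of t x y] x y t by simp
    then have "g (x + t *\<^sub>R d) - g x \<le> t * (g y - g x)"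
      by (simp add: algebra_simps)
    then show "(g (x + t *\<^sub>R d) - g x) / t \<le> g y - g x"
      using t by (simp add: divide_le_eq mult.commute)
  qed simp
  ultimately have "d \<bullet> D \<le> g y - g x"
    by (rule tendsto_upperbound) simp
  then show ?thesis
    by (simp add: d_def inner_commute)
qed

section \<open>Strongly monotone variational inequalities and one optimistic step\<close>

lemma norm_diff_scaleR_square:
  fixes a b :: "'a::real_inner"
  shows "(norm (a - c *\<^sub>R b))\<^sup>2 = (norm a)\<^sup>2 - 2 * c * (a \<bullet> b) + c\<^sup>2 * (norm b)\<^sup>2"
  unfolding power2_norm_eq_inner power2_eq_square[of c]
  by (simp add: inner_diff_left inner_diff_right inner_commute algebra_simps)

lemma norm_add_square_le:
  fixes a b :: "'a::real_inner"
  assumes "\<epsilon> > 0"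
  shows "(norm (a + b))\<^sup>2 \<le> (1 + \<epsilon>) * (norm a)\<^sup>2 + (1 + 1 / \<epsilon>) * (norm b)\<^sup>2"
proof -
  have "0 \<le> (sqrt \<epsilon> * norm a - norm b / sqrt \<epsilon>)\<^sup>2"
    by simp
  then have "2 * norm a * norm b \<le> \<epsilon> * (norm a)\<^sup>2 + (norm b)\<^sup>2 / \<epsilon>"
    using assms by (simp add: power2_diff power_mult_distrib power_divide)
  moreover have "(norm (a + b))\<^sup>2 \<le> (norm a + norm b)\<^sup>2"
    by (intro power_mono norm_triangle_ineq) simp
  ultimately show ?thesis
    by (simp add: power2_sum algebra_simps)
qed

text \<open>Equivalently, \<open>w\<close> lies in \<open>S\<close> and \<open>- G w\<close> in the
  normal cone at \<open>w\<close>. For a saddle operator on a product set this states the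
  first-order conditions of both players at once.\<close>

definition solves_VI :: "'a::real_inner set \<Rightarrow> ('a \<Rightarrow> 'a) \<Rightarrow> 'a \<Rightarrow> bool" where
  "solves_VI S G w \<longleftrightarrow> w \<in> S \<and> (\<forall>q\<in>S. 0 \<le> G w \<bullet> (q - w))"

text \<open>The map \<open>\<phi>\<close>, a projected step along \<open>- G\<close>, is a
  contraction of \<open>S\<close> when the step is small. By the obtuse-angle property of the
  projection, its Banach fixed point solves the inequality.\<close>

lemma strongly_monotone_VI_exists:
  fixes G :: "'a::euclidean_space \<Rightarrow> 'a"
  assumes S: "convex S" "closed S" "S \<noteq> {}" and "\<mu> > 0"
    and mono: "\<And>w w'. w \<in> S \<Longrightarrow> w' \<in> S \<Longrightarrow> \<mu> * (norm (w - w'))\<^sup>2 \<le> (G w - G w') \<bullet> (w - w')"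
    and lip: "\<And>w w'. w \<in> S \<Longrightarrow> w' \<in> S \<Longrightarrow> norm (G w - G w') \<le> l * norm (w - w')"
  shows "\<exists>w. solves_VI S G w"
proof -
  \<comment> \<open>Enlarging the Lipschitz constant to \<open>k\<close> ensures
    \<open>\<mu> \<le> k\<close>, hence \<open>\<eta> * \<mu> \<le> 1\<close>, and the square root
    defining \<open>c\<close> has a nonnegative argument.\<close>
  define k where "k = \<bar>l\<bar> + \<mu>"
  define \<eta> where "\<eta> = \<mu> / k\<^sup>2"
  have "k > 0" "\<mu> \<le> k" "l \<le> k"
    using \<open>\<mu> > 0\<close> by (auto simp: k_def)
  then have "\<eta> > 0"
    using \<open>\<mu> > 0\<close> by (simp add: \<eta>_def)
  define c where "c = sqrt (1 - \<eta> * \<mu>)"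
  have "\<mu>\<^sup>2 \<le> k\<^sup>2"
    using \<open>\<mu> > 0\<close> \<open>\<mu> \<le> k\<close> by (intro power_mono) auto
  then have "0 \<le> 1 - \<eta> * \<mu>"
    using \<open>k > 0\<close> by (simp add: \<eta>_def power2_eq_square)
  moreover have "\<eta> * \<mu> > 0"
    using \<open>\<eta> > 0\<close> \<open>\<mu> > 0\<close> by simp
  ultimately have c: "0 \<le> c" "c < 1" "c\<^sup>2 = 1 - \<eta> * \<mu>"
    by (auto simp: c_def)
  define \<phi> where "\<phi> w = closest_point S (w - \<eta> *\<^sub>R G w)" for w
  have "dist (\<phi> w) (\<phi> w') \<le> c * dist w w'" if w: "w \<in> S" "w' \<in> S" for w w'
  proof -
    have "norm (G w - G w') \<le> k * norm (w - w')"
      using lip[OF w] mult_right_mono[OF \<open>l \<le> k\<close>, of "norm (w - w')"] by simp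
    then have "(norm (G w - G w'))\<^sup>2 \<le> (k * norm (w - w'))\<^sup>2"
      by (intro power_mono) auto
    then have "\<eta>\<^sup>2 * (norm (G w - G w'))\<^sup>2 \<le> \<eta>\<^sup>2 * (k * norm (w - w'))\<^sup>2"
      by (intro mult_left_mono) auto
    also have "\<dots> = \<eta> * \<mu> * (norm (w - w'))\<^sup>2"
      using \<open>k > 0\<close> by (simp add: \<eta>_def power2_eq_square)
    finally have 1: "\<eta>\<^sup>2 * (norm (G w - G w'))\<^sup>2 \<le> \<eta> * \<mu> * (norm (w - w'))\<^sup>2" .
    have "\<eta> * (\<mu> * (norm (w - w'))\<^sup>2) \<le> \<eta> * ((G w - G w') \<bullet> (w - w'))"
      using mono[OF w] \<open>\<eta> > 0\<close> by (intro mult_left_mono) auto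
    moreover have "(norm ((w - w') - \<eta> *\<^sub>R (G w - G w')))\<^sup>2 = (norm (w - w'))\<^sup>2
        - 2 * (\<eta> * ((G w - G w') \<bullet> (w - w'))) + \<eta>\<^sup>2 * (norm (G w - G w'))\<^sup>2"
      by (simp only: norm_diff_scaleR_square) (simp add: inner_commute)
    ultimately have "(norm ((w - w') - \<eta> *\<^sub>R (G w - G w')))\<^sup>2 \<le> (1 - \<eta> * \<mu>) * (norm (w - w'))\<^sup>2"
      using 1 by (simp add: left_diff_distrib)
    also have "\<dots> = (c * norm (w - w'))\<^sup>2"
      by (simp add: power_mult_distrib c)
    finally have "norm ((w - w') - \<eta> *\<^sub>R (G w - G w')) \<le> c * norm (w - w')"
      using c by (simp add: power2_le_iff_abs_le)
    moreover have "dist (\<phi> w) (\<phi> w') \<le> norm ((w - w') - \<eta> *\<^sub>R (G w - G w'))"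
      using closest_point_lipschitz[OF S, of "w - \<eta> *\<^sub>R G w" "w' - \<eta> *\<^sub>R G w'"]
      by (simp add: \<phi>_def dist_norm algebra_simps)
    ultimately show ?thesis
      by (simp add: dist_norm)
  qed
  moreover have "\<phi> ` S \<subseteq> S"
    using S by (auto simp: \<phi>_def intro!: closest_point_in_set)
  ultimately obtain w where w: "w \<in> S" "\<phi> w = w"
    using Banach_fix[of S c \<phi>] S c by (metis complete_eq_closed)
  have "0 \<le> G w \<bullet> (q - w)" if "q \<in> S" for q
  proof -
    have "(w - \<eta> *\<^sub>R G w - w) \<bullet> (q - w) \<le> 0"
      using closest_point_dot[OF S(1,2) that, of "w - \<eta> *\<^sub>R G w"] w by (simp add: \<phi>_def)
    then show ?thesis
      using \<open>\<eta> > 0\<close> by (simp add: mult_le_0_iff zero_le_mult_iff)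
  qed
  then show ?thesis
    using w unfolding solves_VI_def by blast
qed

text \<open>Each inequality is tested at the solution of the other. Their sum and strong
  monotonicity leave only the difference of the two operators at \<open>w'\<close>.\<close>

lemma solves_VI_perturb:
  fixes G G' :: "'a::real_inner \<Rightarrow> 'a"
  assumes "\<mu> > 0" and w: "solves_VI S G w" and w': "solves_VI S G' w'"
    and mono: "\<mu> * (norm (w - w'))\<^sup>2 \<le> (G w - G w') \<bullet> (w - w')"
  shows "\<mu> * norm (w - w') \<le> norm (G' w' - G w')"
proof -
  have "0 \<le> G w \<bullet> (w' - w)" "0 \<le> G' w' \<bullet> (w - w')"
    using w w' by (auto simp: solves_VI_def)
  then have "(G w - G w') \<bullet> (w - w') \<le> (G' w' - G w') \<bullet> (w - w')"
    by (simp add: inner_diff)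
  also have "\<dots> \<le> norm (G' w' - G w') * norm (w - w')"
    by (rule norm_cauchy_schwarz)
  finally have "\<mu> * norm (w - w') * norm (w - w') \<le> norm (G' w' - G w') * norm (w - w')"
    using mono by (simp add: power2_eq_square)
  then show ?thesis
    by (cases "w = w'") auto
qed

text \<open>Strong monotonicity is applied at the new point \<open>w'\<close>, where the step used
  \<open>G w + \<xi>\<close> instead of \<open>G w'\<close>. Young's inequality splits this error,
  and the step size condition charges its Lipschitz part to half of the squared step length. The
  other half stays on the right to pay for the next correction \<open>\<xi>\<close>.\<close>

lemma ogda_step_inequality:
  fixes G :: "'a::real_inner \<Rightarrow> 'a"
  assumes S: "w \<in> S" "w' \<in> S" and sol: "solves_VI S G s" and "\<mu> > 0" "\<eta> > 0"
    and mono: "\<mu> * (norm (w' - s))\<^sup>2 \<le> (G w' - G s) \<bullet> (w' - s)"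
    and lip: "norm (G w - G w') \<le> l * norm (w - w')"
    and step: "4 * \<eta> * l\<^sup>2 \<le> \<mu>"
    and proj: "(w - \<eta> *\<^sub>R (G w + \<xi>) - w') \<bullet> (s - w') \<le> 0"
  shows "(1 + \<eta> * \<mu>) * (norm (w' - s))\<^sup>2
    \<le> (norm (w - s))\<^sup>2 - (norm (w' - w))\<^sup>2 / 2 + 2 * \<eta> / \<mu> * (norm \<xi>)\<^sup>2"
proof -
  define d where "d = norm (w' - w)"
  define q where "q = norm (w' - s)"
  have "0 \<le> G s \<bullet> (w' - s)"
    using sol S by (auto simp: solves_VI_def)
  then have 1: "\<mu> * q\<^sup>2 \<le> G w' \<bullet> (w' - s)"
    using mono by (simp add: q_def inner_diff)
  have "(G w + \<xi> - G w') \<bullet> (s - w') \<le> norm (G w - G w' + \<xi>) * q"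
    using norm_cauchy_schwarz[of "G w + \<xi> - G w'" "s - w'"]
    by (simp add: q_def norm_minus_commute algebra_simps)
  also have "\<dots> \<le> (l * d + norm \<xi>) * q"
    using lip norm_triangle_ineq[of "G w - G w'" \<xi>]
    by (intro mult_right_mono) (auto simp: d_def q_def norm_minus_commute)
  finally have 2: "(G w + \<xi> - G w') \<bullet> (s - w') \<le> (l * d + norm \<xi>) * q" .
  have 3: "2 * (l * d + norm \<xi>) * q \<le> \<mu> * q\<^sup>2 + 2 / \<mu> * (l\<^sup>2 * d\<^sup>2 + (norm \<xi>)\<^sup>2)"
  proof -
    \<comment> \<open>The first square is Young's inequality; the second supplies \<open>(l * d +
      norm \<xi>)^2 \<le> 2 * (l^2 * d^2 + (norm \<xi>)^2)\<close>.\<close>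
    have "0 \<le> (\<mu> * q - (l * d + norm \<xi>))\<^sup>2 + (l * d - norm \<xi>)\<^sup>2"
      by simp
    then have "\<mu> * (2 * (l * d + norm \<xi>) * q) \<le> \<mu> * (\<mu> * q\<^sup>2) + 2 * (l\<^sup>2 * d\<^sup>2 + (norm \<xi>)\<^sup>2)"
      by (simp add: power2_eq_square algebra_simps)
    then have "2 * (l * d + norm \<xi>) * q \<le> (\<mu> * (\<mu> * q\<^sup>2) + 2 * (l\<^sup>2 * d\<^sup>2 + (norm \<xi>)\<^sup>2)) / \<mu>"
      using \<open>\<mu> > 0\<close> by (simp add: le_divide_eq mult.commute)
    then show ?thesis
      using \<open>\<mu> > 0\<close> by (simp add: add_divide_distrib)
  qed
  have "(norm (w - s))\<^sup>2 = (norm (w - w'))\<^sup>2 + q\<^sup>2 - 2 * ((w - w') \<bullet> (s - w'))"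
    by (simp add: q_def power2_norm_eq_inner inner_diff inner_commute algebra_simps)
  then have "q\<^sup>2 \<le> (norm (w - s))\<^sup>2 - d\<^sup>2 + 2 * \<eta> * ((G w + \<xi>) \<bullet> (s - w'))"
    using proj by (simp add: d_def norm_minus_commute inner_diff inner_add_left algebra_simps)
  also have "(G w + \<xi>) \<bullet> (s - w') \<le> - \<mu> * q\<^sup>2 + (l * d + norm \<xi>) * q"
    using 1 2 by (simp add: inner_diff inner_add_left algebra_simps)
  finally have "q\<^sup>2 \<le> (norm (w - s))\<^sup>2 - d\<^sup>2 + 2 * \<eta> * (- \<mu> * q\<^sup>2 + (l * d + norm \<xi>) * q)"
    using \<open>\<eta> > 0\<close> by simp
  moreover have "\<eta> * (2 * (l * d + norm \<xi>) * q) \<le> \<eta> * (\<mu> * q\<^sup>2 + 2 / \<mu> * (l\<^sup>2 * d\<^sup>2 + (norm \<xi>)\<^sup>2))"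
    using 3 \<open>\<eta> > 0\<close> by (intro mult_left_mono) auto
  moreover have "\<eta> * (2 / \<mu> * (l\<^sup>2 * d\<^sup>2)) \<le> d\<^sup>2 / 2"
  proof -
    have "4 * \<eta> * l\<^sup>2 * d\<^sup>2 \<le> \<mu> * d\<^sup>2"
      using step by (intro mult_right_mono) auto
    then show ?thesis
      using \<open>\<mu> > 0\<close> by (simp add: field_simps)
  qed
  ultimately show ?thesis
    unfolding d_def[symmetric] q_def[symmetric] by (simp add: distrib_left distrib_right right_diff_distrib)
qed

section \<open>The smoothed saddle problem\<close>

lemma midpoint_norm_square:
  fixes y y' v :: "'a::real_inner"
  shows "(norm ((1 / 2) *\<^sub>R (y + y') - v))\<^sup>2
    = ((norm (y - v))\<^sup>2 + (norm (y' - v))\<^sup>2) / 2 - (norm (y - y'))\<^sup>2 / 4"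
proof -
  define a where "a = y - v"
  define b where "b = y' - v"
  have "(1 / 2) *\<^sub>R (y + y') - v = (1 / 2) *\<^sub>R (a + b)"
    by (simp add: a_def b_def algebra_simps flip: scaleR_2)
  moreover have "y - y' = a - b"
    by (simp add: a_def b_def)
  ultimately show ?thesis
    by (simp only: a_def[symmetric] b_def[symmetric])
      (simp add: power2_norm_eq_inner inner_add inner_diff inner_commute field_simps)
qed

text \<open>The common setting of the convex and the KL case. The bound on \<open>min_x f X\<close>
  over \<open>Y\<close> keeps the supremum in \<open>D\<close> finite and the potential bounded
  below.\<close>

locale smooth_minimax =
  fixes f :: "'a::euclidean_space \<Rightarrow> 'b::euclidean_space \<Rightarrow> real"
    and X :: "'a set" and Y :: "'b set" and L :: real
  assumes X: "X \<noteq> {}" "compact X" "convex X"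
    and Y: "Y \<noteq> {}" "closed Y" "convex Y"
    and L_pos: "L > 0"
    and lip: "lipschitz_partial_gradients f X Y L"
    and deriv_x: "\<And>x y. GDERIV (\<lambda>u. f u y) x :> grad_x f x y"
    and deriv_y: "\<And>x y. GDERIV (\<lambda>w. f x w) y :> grad_y f x y"
    and bdd_min_x: "bdd_above (min_x f X ` Y)"
begin

definition H where "H w = (grad_x f (fst w) (snd w), - grad_y f (fst w) (snd w))"

text \<open>With \<open>u = (z, v)\<close> this is the pair of \<open>G_x\<close> and
  \<open>G_y\<close> for \<open>r\<^sub>x = r\<^sub>y = 4 * L\<close>; the sign change in the second
  component gives both proximal terms the same sign.\<close>

definition G where "G u w = H w + (4 * L) *\<^sub>R (w - u)"

definition saddle where "saddle u = (SOME w. solves_VI (X \<times> Y) (G u) w)"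

abbreviation F where "F u x y \<equiv> smoothed f (4 * L) (4 * L) x y (fst u) (snd u)"

definition P where "P u = F u (fst (saddle u)) (snd (saddle u))"

definition D where "D v = (SUP y\<in>Y. min_x f X y - 2 * L * (norm (y - v))\<^sup>2)"

section \<open>Regularity of the saddle operator and of the saddle point\<close>

lemma H_lipschitz:
  assumes "w \<in> X \<times> Y" "w' \<in> X \<times> Y"
  shows "norm (H w - H w') \<le> 2 * L * norm (w - w')"
proof -
  obtain x y x' y' where w: "w = (x, y)" "w' = (x', y')"
    by (meson surj_pair)
  define a where "a = norm (x - x')"
  define b where "b = norm (y - y')"
  have "norm (grad_x f x y - grad_x f x' y') \<le> L * (a + b)"
    "norm (grad_y f x y - grad_y f x' y') \<le> L * (a + b)"
    using assms lip by (auto simp: lipschitz_partial_gradients_def w a_def b_def)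
  then have "(norm (grad_x f x y - grad_x f x' y'))\<^sup>2 \<le> (L * (a + b))\<^sup>2"
    "(norm (grad_y f x y - grad_y f x' y'))\<^sup>2 \<le> (L * (a + b))\<^sup>2"
    by (auto intro: power_mono)
  moreover have "2 * (L * (a + b))\<^sup>2 \<le> (2 * L)\<^sup>2 * (a\<^sup>2 + b\<^sup>2)"
  proof -
    have "0 \<le> 2 * L\<^sup>2 * (a - b)\<^sup>2"
      by simp
    then show ?thesis
      by (simp add: power2_eq_square algebra_simps)
  qed
  ultimately have "(norm (grad_x f x y - grad_x f x' y'))\<^sup>2 + (norm (grad_y f x y - grad_y f x' y'))\<^sup>2
      \<le> (2 * L)\<^sup>2 * (a\<^sup>2 + b\<^sup>2)"
    by linarith
  then have "(norm (H w - H w'))\<^sup>2 \<le> (2 * L * norm (w - w'))\<^sup>2"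
    by (simp add: H_def w a_def b_def norm_Pair power_mult_distrib norm_minus_commute)
  then show ?thesis
    using L_pos by (simp add: power2_le_iff_abs_le)
qed

text \<open>A \<open>2 * L\<close>-Lipschitz operator is monotone up to a defect
  \<open>2 * L\<close>, so a regularization of weight \<open>4 * L\<close> leaves the modulus
  \<open>2 * L\<close>.\<close>

lemma G_strongly_monotone:
  assumes "w \<in> X \<times> Y" "w' \<in> X \<times> Y"
  shows "2 * L * (norm (w - w'))\<^sup>2 \<le> (G u w - G u w') \<bullet> (w - w')"
proof -
  have "- ((H w - H w') \<bullet> (w - w')) \<le> norm (H w - H w') * norm (w - w')"
    using Cauchy_Schwarz_ineq2[of "H w - H w'" "w - w'"] by linarith
  also have "\<dots> \<le> 2 * L * norm (w - w') * norm (w - w')"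
    by (intro mult_right_mono H_lipschitz assms) simp
  finally have "- ((H w - H w') \<bullet> (w - w')) \<le> 2 * L * (norm (w - w'))\<^sup>2"
    by (simp add: power2_eq_square)
  moreover have "G u w - G u w' = (H w - H w') + (4 * L) *\<^sub>R (w - w')"
    by (simp add: G_def algebra_simps)
  ultimately show ?thesis
    by (simp add: inner_add_left power2_norm_eq_inner[symmetric])
qed

lemma G_lipschitz:
  assumes "w \<in> X \<times> Y" "w' \<in> X \<times> Y"
  shows "norm (G u w - G u' w') \<le> 6 * L * norm (w - w') + 4 * L * norm (u - u')"
proof -
  have "G u w - G u' w' = (H w - H w') + (4 * L) *\<^sub>R (w - w') - (4 * L) *\<^sub>R (u - u')"
    by (simp add: G_def algebra_simps)
  also have "norm \<dots> \<le> norm (H w - H w') + norm ((4 * L) *\<^sub>R (w - w')) + norm ((4 * L) *\<^sub>R (u - u'))"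
    by (intro order_trans[OF norm_triangle_ineq4] add_right_mono norm_triangle_ineq)
  also have "\<dots> \<le> 6 * L * norm (w - w') + 4 * L * norm (u - u')"
    using H_lipschitz[OF assms] L_pos by simp
  finally show ?thesis .
qed

lemma saddle_solves_VI: "solves_VI (X \<times> Y) (G u) (saddle u)"
proof -
  have "\<exists>w. solves_VI (X \<times> Y) (G u) w"
  proof (rule strongly_monotone_VI_exists[OF _ _ _ _ G_strongly_monotone])
    show "norm (G u w - G u w') \<le> 6 * L * norm (w - w')"
      if "w \<in> X \<times> Y" "w' \<in> X \<times> Y" for w w'
      using G_lipschitz[OF that, of u u] by simp
  qed (use X Y L_pos in \<open>auto simp: compact_imp_closed intro!: convex_Times closed_Times\<close>)
  then show ?thesis
    unfolding saddle_def by (rule someI_ex)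
qed

lemma saddle_in: "saddle u \<in> X \<times> Y" "fst (saddle u) \<in> X" "snd (saddle u) \<in> Y"
  using saddle_solves_VI[of u] by (auto simp: solves_VI_def mem_Times_iff)

lemma saddle_lipschitz: "norm (saddle u - saddle u') \<le> 2 * norm (u - u')"
proof -
  have "2 * L * norm (saddle u - saddle u') \<le> norm (G u' (saddle u') - G u (saddle u'))"
    by (rule solves_VI_perturb[OF _ saddle_solves_VI saddle_solves_VI])
      (use L_pos in \<open>auto intro!: G_strongly_monotone saddle_in\<close>)
  also have "\<dots> \<le> 4 * L * norm (u - u')"
    using G_lipschitz[OF saddle_in(1) saddle_in(1), of u' u' u u']
    by (simp add: norm_minus_commute)
  finally have "L * (2 * norm (saddle u - saddle u')) \<le> L * (4 * norm (u - u'))"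
    by simp
  then show ?thesis
    using L_pos by simp
qed

section \<open>The saddle inequalities and the drift of the saddle value\<close>

lemma f_x_lower:
  assumes "x \<in> X" "x' \<in> X" "y \<in> Y"
  shows "f x' y \<ge> f x y + grad_x f x y \<bullet> (x' - x) - L / 2 * (norm (x' - x))\<^sup>2"
proof (rule lipschitz_gradient_lower_bound[of X _ _ "\<lambda>x. f x y" "\<lambda>x. grad_x f x y"])
  fix u assume "u \<in> X"
  then have "norm (grad_x f u y - grad_x f x y) \<le> L * (norm (u - x) + norm (y - y))"
    using lip assms unfolding lipschitz_partial_gradients_def by blast
  then show "norm (grad_x f u y - grad_x f x y) \<le> L * norm (u - x)"
    by simp
qed (use X assms deriv_x in auto)

lemma f_y_upper:
  assumes "x \<in> X" "y \<in> Y" "y' \<in> Y"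
  shows "f x y' \<le> f x y + grad_y f x y \<bullet> (y' - y) + L / 2 * (norm (y' - y))\<^sup>2"
proof -
  have "- f x y' \<ge> - f x y + (- grad_y f x y) \<bullet> (y' - y) - L / 2 * (norm (y' - y))\<^sup>2"
  proof (rule lipschitz_gradient_lower_bound[of Y _ _ "\<lambda>y. - f x y" "\<lambda>y. - grad_y f x y"])
    fix u assume "u \<in> Y"
    then have "norm (grad_y f x u - grad_y f x y) \<le> L * (norm (x - x) + norm (u - y))"
      using lip assms unfolding lipschitz_partial_gradients_def by blast
    then show "norm (- grad_y f x u - - grad_y f x y) \<le> L * norm (u - y)"
      by (simp add: norm_minus_commute)
  qed (use Y assms deriv_y in \<open>auto intro: GDERIV_minus\<close>)
  then show ?thesis
    by simp
qed

text \<open>The inequality tested along \<open>x\<close> alone is the first-order condition of the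
  minimizer. It suffices for a global minimum, because the proximal term \<open>2 * L\<close>
  outweighs the possible concavity \<open>L / 2\<close> of \<open>f\<close> in
  \<open>x\<close>.\<close>

lemma saddle_minimizes:
  assumes "x \<in> X"
  shows "P u \<le> F u x (snd (saddle u))"
proof -
  define s where "s = fst (saddle u)"
  define y where "y = snd (saddle u)"
  define z where "z = fst u"
  have "0 \<le> G u (saddle u) \<bullet> ((x, y) - saddle u)"
    using saddle_solves_VI[of u] assms by (auto simp: solves_VI_def y_def mem_Times_iff)
  then have 1: "0 \<le> (grad_x f s y + (4 * L) *\<^sub>R (s - z)) \<bullet> (x - s)"
    by (cases "saddle u") (simp add: G_def H_def s_def y_def z_def inner_prod_def)
  have 2: "f x y \<ge> f s y + grad_x f s y \<bullet> (x - s) - L / 2 * (norm (x - s))\<^sup>2"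
    by (rule f_x_lower) (use assms in \<open>auto simp: s_def y_def saddle_in\<close>)
  have "(norm (x - z))\<^sup>2 = (norm (s - z))\<^sup>2 + 2 * ((s - z) \<bullet> (x - s)) + (norm (x - s))\<^sup>2"
    by (simp add: power2_norm_eq_inner inner_diff inner_commute algebra_simps)
  then have 3: "2 * L * (norm (x - z))\<^sup>2 = 2 * L * (norm (s - z))\<^sup>2
      + 4 * L * ((s - z) \<bullet> (x - s)) + 2 * L * (norm (x - s))\<^sup>2"
    by (simp add: distrib_left)
  have "0 \<le> L * (norm (x - s))\<^sup>2"
    using L_pos by simp
  then have "f s y + 2 * L * (norm (s - z))\<^sup>2 \<le> f x y + 2 * L * (norm (x - z))\<^sup>2"
    using 1 2 3 unfolding inner_add_left inner_scaleR_left by linarith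
  then show ?thesis
    by (simp add: P_def smoothed_def s_def y_def z_def)
qed

lemma saddle_maximizes:
  assumes "y \<in> Y"
  shows "F u (fst (saddle u)) y \<le> P u"
proof -
  define s where "s = snd (saddle u)"
  define x where "x = fst (saddle u)"
  define v where "v = snd u"
  have "0 \<le> G u (saddle u) \<bullet> ((x, y) - saddle u)"
    using saddle_solves_VI[of u] assms by (auto simp: solves_VI_def x_def mem_Times_iff)
  then have 1: "0 \<le> (- grad_y f x s + (4 * L) *\<^sub>R (s - v)) \<bullet> (y - s)"
    by (cases "saddle u") (simp add: G_def H_def s_def x_def v_def inner_prod_def)
  have 2: "f x y \<le> f x s + grad_y f x s \<bullet> (y - s) + L / 2 * (norm (y - s))\<^sup>2"
    by (rule f_y_upper) (use assms in \<open>auto simp: s_def x_def saddle_in\<close>)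
  have "(norm (y - v))\<^sup>2 = (norm (s - v))\<^sup>2 + 2 * ((s - v) \<bullet> (y - s)) + (norm (y - s))\<^sup>2"
    by (simp add: power2_norm_eq_inner inner_diff inner_commute algebra_simps)
  then have 3: "2 * L * (norm (y - v))\<^sup>2 = 2 * L * (norm (s - v))\<^sup>2
      + 4 * L * ((s - v) \<bullet> (y - s)) + 2 * L * (norm (y - s))\<^sup>2"
    by (simp add: distrib_left)
  have "0 \<le> L * (norm (y - s))\<^sup>2"
    using L_pos by simp
  then have "f x y - 2 * L * (norm (y - v))\<^sup>2 \<le> f x s - 2 * L * (norm (s - v))\<^sup>2"
    using 1 2 3 unfolding inner_add_left inner_scaleR_left inner_minus_left by linarith
  then show ?thesis
    by (simp add: P_def smoothed_def s_def x_def v_def)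
qed

text \<open>Both values are compared at the mixed point of the old minimizer and the new maximizer.
  The value of \<open>f\<close> there is the same for \<open>u\<close> and \<open>u'\<close> and
  cancels, so only proximal terms remain.\<close>

lemma P_change:
  "P u' \<le> P u + 2 * L * ((norm (fst (saddle u) - fst u'))\<^sup>2 - (norm (fst (saddle u) - fst u))\<^sup>2)
    - 2 * L * ((norm (snd (saddle u') - snd u'))\<^sup>2 - (norm (snd (saddle u') - snd u))\<^sup>2)"
  using saddle_minimizes[OF saddle_in(2)[of u], of u'] saddle_maximizes[OF saddle_in(3)[of u'], of u]
  by (simp add: smoothed_def algebra_simps)

section \<open>The dual function \<open>D\<close> and its drift\<close>

lemma continuous_on_f_x: "continuous_on S (\<lambda>x. f x y)"
  using deriv_x by (intro continuous_at_imp_continuous_on ballI has_derivative_continuous)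
    (auto simp: gderiv_def)

lemma min_x_le: "x \<in> X \<Longrightarrow> min_x f X y \<le> f x y"
  unfolding min_x_def using X
  by (intro cINF_lower bounded_imp_bdd_below compact_imp_bounded compact_continuous_image
      continuous_on_f_x)

lemma D_bdd_above: "bdd_above ((\<lambda>y. min_x f X y - 2 * L * (norm (y - v))\<^sup>2) ` Y)"
proof -
  obtain B where "\<And>y. y \<in> Y \<Longrightarrow> min_x f X y \<le> B"
    using bdd_min_x by (auto simp: bdd_above_def)
  moreover have "0 \<le> 2 * L * (norm (y - v))\<^sup>2" for y
    using L_pos by simp
  ultimately show ?thesis
    by (intro bdd_aboveI2[of _ _ B]) (smt (verit))
qed

lemma D_upper: "y \<in> Y \<Longrightarrow> min_x f X y - 2 * L * (norm (y - v))\<^sup>2 \<le> D v"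
  unfolding D_def by (intro cSUP_upper D_bdd_above)

lemma D_le:
  assumes "\<And>y. y \<in> Y \<Longrightarrow> min_x f X y \<le> B"
  shows "D v \<le> B"
  unfolding D_def
proof (rule cSUP_least)
  fix y assume "y \<in> Y"
  moreover have "0 \<le> 2 * L * (norm (y - v))\<^sup>2"
    using L_pos by simp
  ultimately show "min_x f X y - 2 * L * (norm (y - v))\<^sup>2 \<le> B"
    using assms[of y] by linarith
qed (rule Y)

text \<open>For each \<open>y\<close>, the minimum over \<open>X\<close> is at most the value at the
  \<open>x\<close>-part of the saddle point, against which the \<open>y\<close>-part is a best
  response.\<close>

lemma D_le_P: "D (snd u) \<le> P u - 2 * L * (norm (fst (saddle u) - fst u))\<^sup>2"
  unfolding D_def
proof (rule cSUP_least)
  fix y assume "y \<in> Y"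
  then show "min_x f X y - 2 * L * (norm (y - snd u))\<^sup>2
      \<le> P u - 2 * L * (norm (fst (saddle u) - fst u))\<^sup>2"
    using saddle_maximizes[of y u] min_x_le[OF saddle_in(2)[of u], of y] by (simp add: smoothed_def)
qed (rule Y)

text \<open>The proximal term in \<open>D_le_P\<close> is the \<open>x\<close>-part of
  \<open>P u\<close> and cancels. Thus the suboptimality of the saddle's \<open>y\<close>-part in
  the problem defining \<open>D\<close> is controlled by a primal gap of \<open>f\<close>, to which
  the KL inequality applies.\<close>

lemma saddle_gap:
  "D (snd u) - (min_x f X (snd (saddle u)) - 2 * L * (norm (snd (saddle u) - snd u))\<^sup>2)
    \<le> f (fst (saddle u)) (snd (saddle u)) - min_x f X (snd (saddle u))"
  using D_le_P[of u] by (simp add: P_def smoothed_def)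

text \<open>Strong concavity in midpoint form, with the midpoint value replaced by its upper bound
  \<open>D v\<close>. The infimum over \<open>x\<close> inherits from \<open>f\<close> a midpoint
  defect of \<open>L / 8\<close>, and the proximal term contributes \<open>L / 2\<close>, which
  leaves \<open>3 * L / 8\<close>.\<close>

lemma min_x_smoothed_strongly_concave:
  assumes "y \<in> Y" "y' \<in> Y"
  defines "g \<equiv> (\<lambda>v y. min_x f X y - 2 * L * (norm (y - v))\<^sup>2)"
  shows "3 * L / 8 * (norm (y - y'))\<^sup>2 \<le> D v - (g v y + g v y') / 2"
proof -
  define m where "m = (1 / 2) *\<^sub>R (y + y')"
  have m: "m \<in> Y"
    using Y(3) assms convexD[of Y y y' "1/2" "1/2"] by (simp add: m_def scaleR_add_right)
  have ym: "y - m = (1 / 2) *\<^sub>R (y - y')" "y' - m = (1 / 2) *\<^sub>R (y' - y)"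
    by (simp_all add: m_def algebra_simps flip: scaleR_2)
  have "(min_x f X y + min_x f X y') / 2 - L / 8 * (norm (y - y'))\<^sup>2 \<le> min_x f X m"
    unfolding min_x_def[of f X m]
  proof (rule cINF_greatest)
    fix x assume x: "x \<in> X"
    have "f x y + f x y' \<le> 2 * f x m + L / 4 * (norm (y - y'))\<^sup>2"
      using f_y_upper[OF x m assms(1)] f_y_upper[OF x m assms(2)]
      by (simp add: ym norm_minus_commute[of y'] power_divide inner_diff diff_divide_distrib)
    then show "(min_x f X y + min_x f X y') / 2 - L / 8 * (norm (y - y'))\<^sup>2 \<le> f x m"
      using min_x_le[OF x, of y] min_x_le[OF x, of y'] by (simp add: field_simps)
  qed (rule X)
  moreover have "min_x f X m - 2 * L * (norm (m - v))\<^sup>2 \<le> D v"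
    by (rule D_upper) (rule m)
  ultimately show ?thesis
    unfolding m_def midpoint_norm_square g_def by (simp add: field_simps)
qed

text \<open>A near-maximizer \<open>y2\<close> for the centre \<open>v\<close> competes at the
  shifted centre, and expanding the square gives a gain
  \<open>4 * L * \<beta> * ((y2 - v) \<bullet> (y - v))\<close> up to second order. Replacing
  \<open>y2\<close> by \<open>y\<close> in it costs the tracking error \<open>s\<close> and, by
  strong concavity, a multiple of the gap \<open>\<gamma>\<close>.\<close>

lemma D_change:
  assumes y1: "y1 \<in> Y" and gap: "D v - (min_x f X y1 - 2 * L * (norm (y1 - v))\<^sup>2) \<le> \<gamma>"
    and s: "norm (y - y1) \<le> s" and "0 < \<beta>"
  defines "b \<equiv> norm (y - v)"
  shows "D (v + \<beta> *\<^sub>R (y - v))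
    \<ge> D v + 4 * L * \<beta> * (7 / 8 * b\<^sup>2 - b * s - 8 / (3 * L) * \<gamma>) - 2 * L * \<beta>\<^sup>2 * b\<^sup>2"
proof (rule field_le_epsilon)
  fix e :: real
  assume "e > 0"
  define g where "g y = min_x f X y - 2 * L * (norm (y - v))\<^sup>2" for y
  \<comment> \<open>The \<open>\<epsilon>\<close>-maximizer loses \<open>\<epsilon>\<close> in the
    value and, through \<open>\<gamma> + \<epsilon>\<close>, another
    \<open>4 * L * \<beta> * 8 / (3 * L) * \<epsilon>\<close>; the total is exactly
    \<open>e\<close>.\<close>
  define \<epsilon> where "\<epsilon> = e / (1 + 32 / 3 * \<beta>)"
  have "\<epsilon> > 0"
    using \<open>e > 0\<close> \<open>\<beta> > 0\<close> by (simp add: \<epsilon>_def add_pos_pos)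
  have \<epsilon>: "\<epsilon> + 32 / 3 * \<beta> * \<epsilon> = e"
    using \<open>\<beta> > 0\<close> by (simp add: \<epsilon>_def divide_simps) (simp add: algebra_simps)
  obtain y2 where y2: "y2 \<in> Y" "D v - \<epsilon> < g y2"
    using less_cSUP_iff[OF Y(1) D_bdd_above, of "D v - \<epsilon>" v] \<open>\<epsilon> > 0\<close> by (auto simp: D_def g_def)
  define q where "q = norm (y2 - y1)"
  have "3 * L / 8 * q\<^sup>2 \<le> D v - (g y2 + g y1) / 2"
    unfolding q_def g_def by (rule min_x_smoothed_strongly_concave) (use y1 y2 in auto)
  then have "3 * L / 8 * q\<^sup>2 \<le> (\<gamma> + \<epsilon>) / 2"
    using y2(2) gap unfolding g_def[of y1, symmetric] by (simp add: field_simps)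
  then have q: "2 * q\<^sup>2 \<le> 8 / (3 * L) * (\<gamma> + \<epsilon>)"
    using L_pos by (simp add: field_simps)
  have "(y2 - v) \<bullet> (y - v) = b\<^sup>2 + (y2 - y1) \<bullet> (y - v) + (y1 - y) \<bullet> (y - v)"
    by (simp add: b_def power2_norm_eq_inner inner_diff inner_commute algebra_simps)
  moreover have "- (q * b) \<le> (y2 - y1) \<bullet> (y - v)"
    using Cauchy_Schwarz_ineq2[of "y2 - y1" "y - v"] by (simp add: q_def b_def)
  moreover have "- (s * b) \<le> (y1 - y) \<bullet> (y - v)"
    using Cauchy_Schwarz_ineq2[of "y1 - y" "y - v"] mult_right_mono[OF s norm_ge_zero[of "y - v"]]
    by (simp add: b_def norm_minus_commute)
  \<comment> \<open>Young's inequality spends an eighth of \<open>b^2\<close> on the distance from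
    \<open>y2\<close> to \<open>y1\<close>; this is the origin of 7/8.\<close>
  moreover have "q * b \<le> b\<^sup>2 / 8 + 2 * q\<^sup>2"
    using zero_le_power2[of "b - 4 * q"] by (simp add: power2_eq_square algebra_simps)
  ultimately have "7 / 8 * b\<^sup>2 - s * b - 8 / (3 * L) * (\<gamma> + \<epsilon>) \<le> (y2 - v) \<bullet> (y - v)"
    using q by linarith
  then have "4 * L * \<beta> * (7 / 8 * b\<^sup>2 - s * b - 8 / (3 * L) * (\<gamma> + \<epsilon>)) \<le> 4 * L * \<beta> * ((y2 - v) \<bullet> (y - v))"
    using L_pos \<open>\<beta> > 0\<close> by (intro mult_left_mono) auto
  moreover have "4 * L * \<beta> * (7 / 8 * b\<^sup>2 - s * b - 8 / (3 * L) * (\<gamma> + \<epsilon>))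
      = 4 * L * \<beta> * (7 / 8 * b\<^sup>2 - s * b - 8 / (3 * L) * \<gamma>) - 32 / 3 * \<beta> * \<epsilon>"
    using L_pos by (simp add: divide_simps) (simp add: algebra_simps)
  moreover have "(norm (y2 - (v + \<beta> *\<^sub>R (y - v))))\<^sup>2
      = (norm (y2 - v))\<^sup>2 - 2 * \<beta> * ((y2 - v) \<bullet> (y - v)) + \<beta>\<^sup>2 * b\<^sup>2"
    using norm_diff_scaleR_square[of "y2 - v" \<beta> "y - v"] by (simp add: b_def diff_diff_add)
  then have "2 * L * (norm (y2 - (v + \<beta> *\<^sub>R (y - v))))\<^sup>2
      = 2 * L * (norm (y2 - v))\<^sup>2 - 4 * L * \<beta> * ((y2 - v) \<bullet> (y - v)) + 2 * L * \<beta>\<^sup>2 * b\<^sup>2"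
    by (simp only: distrib_left right_diff_distrib)
  moreover have "min_x f X y2 - 2 * L * (norm (y2 - (v + \<beta> *\<^sub>R (y - v))))\<^sup>2 \<le> D (v + \<beta> *\<^sub>R (y - v))"
    by (rule D_upper) (rule y2)
  ultimately have "D v + 4 * L * \<beta> * (7 / 8 * b\<^sup>2 - s * b - 8 / (3 * L) * \<gamma>) - 2 * L * \<beta>\<^sup>2 * b\<^sup>2
      \<le> D (v + \<beta> *\<^sub>R (y - v)) + e"
    using y2(2) \<epsilon> unfolding g_def by linarith
  then show "D v + 4 * L * \<beta> * (7 / 8 * b\<^sup>2 - b * s - 8 / (3 * L) * \<gamma>) - 2 * L * \<beta>\<^sup>2 * b\<^sup>2
      \<le> D (v + \<beta> *\<^sub>R (y - v)) + e"
    by (simp add: mult.commute)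
qed

end

section \<open>Descent of the potential\<close>

text \<open>The left side is the geometric mean of \<open>1 / T\<close> and \<open>q^2\<close> with
  weights \<open>1 - p / 2\<close> and \<open>p / 2\<close>, hence at most the larger of the
  two.\<close>

lemma powr_interpolation:
  fixes q T p :: real
  assumes "0 \<le> q" "0 < T" "0 \<le> p" "p \<le> 2"
  shows "T powr (- (1 - p / 2)) * q powr p \<le> q\<^sup>2 + 1 / T"
proof (cases "q = 0")
  case False
  then have "q > 0"
    using assms by simp
  have q: "q powr p = (q\<^sup>2) powr (p / 2)"
  proof -
    have "q\<^sup>2 = q powr 2"
      using powr_realpow[OF \<open>q > 0\<close>, of 2] by simp
    show ?thesis
      unfolding \<open>q\<^sup>2 = q powr 2\<close> powr_powr by simp
  qed
  show ?thesis
  proof (cases "1 / T \<le> q\<^sup>2")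
    case True
    have "T powr (- (1 - p / 2)) = (1 / T) powr (1 - p / 2)"
      unfolding powr_minus_divide using \<open>0 < T\<close> by (simp add: powr_divide)
    also have "\<dots> \<le> (q\<^sup>2) powr (1 - p / 2)"
      using True assms by (intro powr_mono2) auto
    finally have "T powr (- (1 - p / 2)) * q powr p \<le> (q\<^sup>2) powr (1 - p / 2) * (q\<^sup>2) powr (p / 2)"
      unfolding q by (intro mult_right_mono) auto
    also have "\<dots> = q\<^sup>2"
      using \<open>q > 0\<close> by (simp flip: powr_add)
    finally show ?thesis
      using \<open>0 < T\<close> by (simp add: add_increasing2)
  next
    case False
    have "(q\<^sup>2) powr (p / 2) \<le> (1 / T) powr (p / 2)"
      using False assms by (intro powr_mono2) auto
    also have "\<dots> = T powr (- (p / 2))"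
      unfolding powr_minus_divide using \<open>0 < T\<close> by (simp add: powr_divide)
    finally have "T powr (- (1 - p / 2)) * q powr p \<le> T powr (- (1 - p / 2)) * T powr (- (p / 2))"
      unfolding q by (intro mult_left_mono) auto
    also have "\<dots> = 1 / T"
      unfolding powr_add[symmetric] using \<open>0 < T\<close> by (simp add: powr_neg_one)
    finally show ?thesis
      by (simp add: add_increasing)
  qed
qed (use assms in simp)

lemma young_inequality:
  fixes a b :: real
  assumes "c > 0"
  shows "a * b \<le> c * a\<^sup>2 + b\<^sup>2 / (4 * c)"
proof -
  have "0 \<le> (2 * c * a - b)\<^sup>2 / (4 * c)"
    using assms by simp
  also have "\<dots> = c * a\<^sup>2 + b\<^sup>2 / (4 * c) - a * b"
    using assms by (simp add: power2_eq_square field_simps)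
  finally show ?thesis
    by simp
qed

section \<open>One step of the tracking error, of \<open>U\<close> and of the full potential\<close>

context smooth_minimax
begin

text \<open>Squared distance to the current saddle point plus the squared optimistic correction
  \<open>\<xi>\<close>, the latest change of the operator value. The weight of \<open>\<xi>\<close>
  is twice its coefficient in \<open>ogda_step\<close>, so this part contracts as well.\<close>

definition E where
  "E u w (\<xi> :: 'a \<times> 'b) = (norm (w - saddle u))\<^sup>2 + (norm \<xi>)\<^sup>2 / (288 * L\<^sup>2)"

text \<open>Moving \<open>v\<close> towards \<open>y\<close> raises \<open>P\<close> and
  \<open>D\<close> by comparable amounts; subtracting \<open>D\<close> twice turns the balance into
  a decrease.\<close>

definition U where "U u = P u - 2 * D (snd u)"

lemma E_nonneg: "0 \<le> E u w \<xi>"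
  by (simp add: E_def)

text \<open>The optimistic step inequality with \<open>\<mu> = 2 * L\<close>,
  \<open>l = 6 * L\<close> and step size \<open>1 / (576 * L)\<close>: then
  \<open>1 + \<eta> * \<mu> = 289 / 288\<close> and
  \<open>2 * \<eta> / \<mu> = 1 / (576 * L^2)\<close>.\<close>

lemma ogda_step:
  assumes "w \<in> X \<times> Y" "w' \<in> X \<times> Y"
    and VI: "\<And>q. q \<in> X \<times> Y \<Longrightarrow> (w - (1 / (576 * L)) *\<^sub>R (G u w + \<xi>) - w') \<bullet> (q - w') \<le> 0"
  shows "289 / 288 * (norm (w' - saddle u))\<^sup>2 + (norm (w' - w))\<^sup>2 / 2
    \<le> (norm (w - saddle u))\<^sup>2 + (norm \<xi>)\<^sup>2 / (576 * L\<^sup>2)"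
proof -
  have "(1 + 1 / (576 * L) * (2 * L)) * (norm (w' - saddle u))\<^sup>2
      \<le> (norm (w - saddle u))\<^sup>2 - (norm (w' - w))\<^sup>2 / 2 + 2 * (1 / (576 * L)) / (2 * L) * (norm \<xi>)\<^sup>2"
  proof (rule ogda_step_inequality[OF assms(1,2) saddle_solves_VI])
    show "norm (G u w - G u w') \<le> 6 * L * norm (w - w')"
      using G_lipschitz[OF assms(1,2), of u u] by simp
  qed (use L_pos VI saddle_in assms G_strongly_monotone in \<open>auto simp: power2_eq_square\<close>)
  then show ?thesis
    using L_pos by (simp add: power2_eq_square)
qed

text \<open>The step contracts towards the old saddle point, and changing to the new one costs the
  Lipschitz drift of \<open>saddle\<close>. The next correction is bounded by the step length, paid
  by the spare \<open>d / 2\<close>, and again by the drift of \<open>u\<close>.\<close>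

lemma E_step:
  assumes w: "w \<in> X \<times> Y" "w' \<in> X \<times> Y"
    and VI: "\<And>q. q \<in> X \<times> Y \<Longrightarrow> (w - (1 / (576 * L)) *\<^sub>R (G u w + \<xi>) - w') \<bullet> (q - w') \<le> 0"
  shows "E u' w' (G u' w' - G u w) \<le> 577 / 578 * E u w \<xi> + 2309 * (norm (u' - u))\<^sup>2"
proof -
  define S where "S = (norm (w - saddle u))\<^sup>2"
  define S' where "S' = (norm (w' - saddle u))\<^sup>2"
  define d where "d = (norm (w' - w))\<^sup>2"
  define k where "k = (norm (u' - u))\<^sup>2"
  define e where "e = (norm \<xi>)\<^sup>2 / (288 * L\<^sup>2)"
  have e: "e \<ge> 0" and d: "d \<ge> 0"
    by (auto simp: e_def d_def)
  have 1: "289 / 288 * S' + d / 2 \<le> S + e / 2"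
    using ogda_step[OF assms] by (simp add: S_def S'_def d_def e_def)
  have "(norm (saddle u - saddle u'))\<^sup>2 \<le> (2 * norm (u - u'))\<^sup>2"
    by (intro power_mono saddle_lipschitz) simp
  then have "(norm (saddle u - saddle u'))\<^sup>2 \<le> 4 * k"
    by (simp add: k_def norm_minus_commute power_mult_distrib)
  \<comment> \<open>The parameter 1/576 is chosen because
    \<open>577 / 578 * (289 / 288) = 577 / 576\<close>.\<close>
  moreover have "(norm (w' - saddle u + (saddle u - saddle u')))\<^sup>2
      \<le> (1 + 1 / 576) * S' + (1 + 1 / (1 / 576)) * (norm (saddle u - saddle u'))\<^sup>2"
    unfolding S'_def by (rule norm_add_square_le) simp
  ultimately have 2: "(norm (w' - saddle u'))\<^sup>2 \<le> 577 / 576 * S' + 2308 * k"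
    by simp
  have "(norm (G u' w' - G u w))\<^sup>2 \<le> (6 * L * norm (w' - w) + 4 * L * norm (u' - u))\<^sup>2"
    using G_lipschitz[OF w(2,1)] by (intro power_mono) auto
  also have "\<dots> \<le> L\<^sup>2 * (72 * d + 32 * k)"
  proof -
    have "0 \<le> L\<^sup>2 * (6 * norm (w' - w) - 4 * norm (u' - u))\<^sup>2"
      by simp
    then show ?thesis
      by (simp add: d_def k_def power2_eq_square algebra_simps)
  qed
  finally have 3: "(norm (G u' w' - G u w))\<^sup>2 / (288 * L\<^sup>2) \<le> d / 4 + k / 9"
    using L_pos by (simp add: divide_simps) (simp add: algebra_simps)
  have "A + B \<le> 577 / 578 * (S + e) + 2309 * k"
    if "A \<le> 577 / 576 * S' + 2308 * k" "B \<le> d / 4 + k / 9" for A B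
  proof -
    have "577 / 578 * (289 / 288 * S' + d / 2) \<le> 577 / 578 * (S + e / 2)"
      using 1 by (intro mult_left_mono) auto
    then have "577 / 576 * S' + d / 4 \<le> 577 / 578 * (S + e)"
      using e d by (simp add: algebra_simps)
    moreover have "2308 * k + k / 9 \<le> 2309 * k"
      by (simp add: k_def)
    moreover have "A + B \<le> (577 / 576 * S' + d / 4) + (2308 * k + k / 9)"
      using add_mono[OF that] by simp
    ultimately show ?thesis
      by (meson add_mono order_trans)
  qed
  from this[OF 2 3] show ?thesis
    by (simp add: E_def S_def e_def k_def)
qed

lemma step_length_le:
  assumes "w \<in> X \<times> Y" "w' \<in> X \<times> Y"
    and VI: "\<And>q. q \<in> X \<times> Y \<Longrightarrow> (w - (1 / (576 * L)) *\<^sub>R (G u w + \<xi>) - w') \<bullet> (q - w') \<le> 0"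
  shows "(norm (w' - w))\<^sup>2 \<le> 2 * E u w \<xi>"
proof -
  have "0 \<le> (norm (w' - saddle u))\<^sup>2" "0 \<le> (norm \<xi>)\<^sup>2 / (576 * L\<^sup>2)"
    by auto
  then have "(norm (w' - w))\<^sup>2 / 2 \<le> (norm (w - saddle u))\<^sup>2 + 2 * ((norm \<xi>)\<^sup>2 / (576 * L\<^sup>2))"
    using ogda_step[OF assms(1,2) VI] by linarith
  then show ?thesis
    by (simp add: E_def)
qed

text \<open>\<open>P u - D (snd u)\<close> is nonnegative, and the second copy of \<open>D\<close>
  is at most \<open>B\<close>.\<close>

lemma U_lower:
  assumes "\<And>y. y \<in> Y \<Longrightarrow> min_x f X y \<le> B"
  shows "- B \<le> U u"
proof -
  have "0 \<le> 2 * L * (norm (fst (saddle u) - fst u))\<^sup>2"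
    using L_pos by simp
  then show ?thesis
    using D_le_P[of u] D_le[OF assms, of "snd u"] unfolding U_def by linarith
qed

text \<open>Moving \<open>z\<close> towards \<open>x\<close>, which is close to the minimizer,
  lowers \<open>P\<close>. Moving \<open>v\<close> towards \<open>y\<close> raises \<open>P\<close>
  by about \<open>4 * L * \<beta> * (norm (y - v))^2\<close> and \<open>2 * D\<close> by about 7/4
  of that. Tracking errors are all charged to \<open>\<alpha>\<close>, using
  \<open>\<beta> \<le> \<alpha>\<close>.\<close>

lemma U_step:
  fixes x z :: 'a and y v :: 'b
  assumes xy: "(x, y) \<in> X \<times> Y" and \<beta>: "0 < \<beta>" "\<beta> \<le> \<alpha>" and \<alpha>: "\<alpha> \<le> 1 / 16"
  defines "u \<equiv> (z, v)" and "u' \<equiv> (z + \<alpha> *\<^sub>R (x - z), v + \<beta> *\<^sub>R (y - v))"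
  defines "\<gamma> \<equiv> f (fst (saddle u)) (snd (saddle u)) - min_x f X (snd (saddle u))"
  shows "U u' \<le> U u + 4 * L * (- \<alpha> / 2 * (norm (x - z))\<^sup>2 - \<beta> / 4 * (norm (y - v))\<^sup>2
      + 19 * \<alpha> * (norm ((x, y) - saddle u))\<^sup>2 + 16 / (3 * L) * (\<beta> * \<gamma>))"
proof -
  define a where "a = norm (x - z)"
  define b where "b = norm (y - v)"
  define s where "s = norm ((x, y) - saddle u)"
  define x1 where "x1 = fst (saddle u)"
  define y1 where "y1 = snd (saddle u)"
  define y2 where "y2 = snd (saddle u')"
  have "0 < \<alpha>" and nonneg: "0 \<le> a" "0 \<le> b" "0 \<le> s"
    using \<beta> by (auto simp: a_def b_def s_def)
  have s: "norm (x1 - x) \<le> s" "norm (y1 - y) \<le> s" "norm (y - y1) \<le> s"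
  proof -
    have "saddle u - (x, y) = (x1 - x, y1 - y)"
      by (simp add: x1_def y1_def prod_eq_iff)
    then have "s = norm (x1 - x, y1 - y)"
      by (metis s_def norm_minus_commute)
    then show "norm (x1 - x) \<le> s" "norm (y1 - y) \<le> s" "norm (y - y1) \<le> s"
      using norm_fst_le[of "x1 - x" "y1 - y"] norm_snd_le[of "y1 - y" "x1 - x"]
      by (simp_all add: norm_minus_commute[of y])
  qed
  have 1: "(norm (x1 - fst u'))\<^sup>2 - (norm (x1 - fst u))\<^sup>2 \<le> - 2 * \<alpha> * a\<^sup>2 + 2 * \<alpha> * (a * s) + \<alpha>\<^sup>2 * a\<^sup>2"
  proof -
    have "(norm (x1 - fst u'))\<^sup>2 = (norm (x1 - z))\<^sup>2 - 2 * \<alpha> * ((x1 - z) \<bullet> (x - z)) + \<alpha>\<^sup>2 * a\<^sup>2"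
      using norm_diff_scaleR_square[of "x1 - z" \<alpha> "x - z"] by (simp add: u'_def a_def diff_diff_add)
    moreover have "(x1 - z) \<bullet> (x - z) = a\<^sup>2 + (x1 - x) \<bullet> (x - z)"
      by (simp add: a_def power2_norm_eq_inner inner_diff)
    moreover have "- (a * s) \<le> (x1 - x) \<bullet> (x - z)"
      using Cauchy_Schwarz_ineq2[of "x1 - x" "x - z"] mult_right_mono[OF s(1) nonneg(1)]
      by (simp add: a_def mult.commute)
    then have "2 * \<alpha> * - (a * s) \<le> 2 * \<alpha> * ((x1 - x) \<bullet> (x - z))"
      using \<open>0 < \<alpha>\<close> by (intro mult_left_mono) auto
    ultimately show ?thesis
      by (simp add: u_def distrib_left)
  qed
  \<comment> \<open>\<open>P_change\<close> refers to the new maximizer \<open>y2\<close>; its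
    drift, at most \<open>2 * norm (u' - u)\<close>, produces the last two terms.\<close>
  have 2: "(norm (y2 - snd u))\<^sup>2 - (norm (y2 - snd u'))\<^sup>2
      \<le> 2 * \<beta> * (b\<^sup>2 + b * s + 2 * \<alpha> * (a * b) + 2 * \<beta> * b\<^sup>2)"
  proof -
    have "(norm (y2 - snd u'))\<^sup>2 = (norm (y2 - v))\<^sup>2 - 2 * \<beta> * ((y2 - v) \<bullet> (y - v)) + \<beta>\<^sup>2 * b\<^sup>2"
      using norm_diff_scaleR_square[of "y2 - v" \<beta> "y - v"] by (simp add: u'_def b_def diff_diff_add)
    moreover have "0 \<le> \<beta>\<^sup>2 * b\<^sup>2"
      by simp
    moreover have "(y2 - v) \<bullet> (y - v) \<le> b\<^sup>2 + b * s + 2 * \<alpha> * (a * b) + 2 * \<beta> * b\<^sup>2"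
    proof -
      have "norm (y2 - y1) \<le> norm (saddle u' - saddle u)"
        unfolding y1_def y2_def by (metis norm_snd_le prod.collapse snd_diff)
      also have "\<dots> \<le> 2 * norm (u' - u)"
        by (rule saddle_lipschitz)
      also have "norm (u' - u) \<le> \<alpha> * a + \<beta> * b"
        using norm_Pair_le[of "\<alpha> *\<^sub>R (x - z)" "\<beta> *\<^sub>R (y - v)"] \<open>0 < \<alpha>\<close> \<beta>
        by (simp add: u_def u'_def a_def b_def)
      finally have "norm (y2 - y1) + norm (y1 - y) \<le> 2 * (\<alpha> * a + \<beta> * b) + s"
        using s by simp
      then have "norm (y2 - y) \<le> 2 * (\<alpha> * a + \<beta> * b) + s"
        using norm_triangle_ineq[of "y2 - y1" "y1 - y"] by simp
      then have "norm (y2 - y) * b \<le> (2 * (\<alpha> * a + \<beta> * b) + s) * b"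
        using nonneg by (intro mult_right_mono)
      moreover have "(y2 - v) \<bullet> (y - v) = b\<^sup>2 + (y2 - y) \<bullet> (y - v)"
        by (simp add: b_def power2_norm_eq_inner inner_diff)
      moreover have "(y2 - y) \<bullet> (y - v) \<le> norm (y2 - y) * b"
        unfolding b_def by (rule norm_cauchy_schwarz)
      ultimately show ?thesis
        by (simp add: power2_eq_square algebra_simps)
    qed
    then have "2 * \<beta> * ((y2 - v) \<bullet> (y - v)) \<le> 2 * \<beta> * (b\<^sup>2 + b * s + 2 * \<alpha> * (a * b) + 2 * \<beta> * b\<^sup>2)"
      using \<beta> by (intro mult_left_mono) auto
    ultimately show ?thesis
      unfolding u_def snd_conv by linarith
  qed
  have 3: "D (snd u') \<ge> D v + 4 * L * \<beta> * (7 / 8 * b\<^sup>2 - b * s - 8 / (3 * L) * \<gamma>) - 2 * L * \<beta>\<^sup>2 * b\<^sup>2"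
    using D_change[of y1 v \<gamma> y s \<beta>] saddle_gap[of u] saddle_in(3)[of u] s \<beta>
    by (simp add: u_def u'_def y1_def \<gamma>_def b_def)
  have "P u' \<le> P u + 2 * L * (- 2 * \<alpha> * a\<^sup>2 + 2 * \<alpha> * (a * s) + \<alpha>\<^sup>2 * a\<^sup>2)
      + 2 * L * (2 * \<beta> * (b\<^sup>2 + b * s + 2 * \<alpha> * (a * b) + 2 * \<beta> * b\<^sup>2))"
  proof -
    have "2 * L * ((norm (x1 - fst u'))\<^sup>2 - (norm (x1 - fst u))\<^sup>2)
      \<le> 2 * L * (- 2 * \<alpha> * a\<^sup>2 + 2 * \<alpha> * (a * s) + \<alpha>\<^sup>2 * a\<^sup>2)"
      using 1 L_pos by (intro mult_left_mono) auto
    moreover have "2 * L * ((norm (y2 - snd u))\<^sup>2 - (norm (y2 - snd u'))\<^sup>2)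
      \<le> 2 * L * (2 * \<beta> * (b\<^sup>2 + b * s + 2 * \<alpha> * (a * b) + 2 * \<beta> * b\<^sup>2))"
      using 2 L_pos by (intro mult_left_mono) auto
    ultimately show ?thesis
      using P_change[of u' u] unfolding x1_def y2_def by (simp add: right_diff_distrib)
  qed
  moreover have "8 * L * \<beta> * (8 / (3 * L) * \<gamma>) = 4 * L * (16 / (3 * L) * (\<beta> * \<gamma>))"
    by simp
  ultimately have 4: "U u' - U u \<le> 4 * L * (- \<alpha> * a\<^sup>2 + \<alpha>\<^sup>2 * a\<^sup>2 / 2 + \<alpha> * (a * s)
      - 3 / 4 * \<beta> * b\<^sup>2 + 3 * \<beta> * (b * s) + 2 * \<beta> * \<alpha> * (a * b) + 3 * \<beta>\<^sup>2 * b\<^sup>2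
      + 16 / (3 * L) * (\<beta> * \<gamma>))"
    using 3 unfolding U_def u_def snd_conv
    by (simp add: algebra_simps power2_eq_square[of \<beta>] less_imp_neq[OF L_pos, symmetric])
  \<comment> \<open>The losses are 1/32 + 1/4 + 1/16 of \<open>\<alpha> * a^2\<close> and 3/24 +
    1/16 + 3/16 of \<open>\<beta> * b^2\<close>, each below 1/2; \<open>s^2\<close> collects 1 + 3 *
    6 = 19.\<close>
  have "- \<alpha> * a\<^sup>2 + \<alpha>\<^sup>2 * a\<^sup>2 / 2 + \<alpha> * (a * s)
      - 3 / 4 * \<beta> * b\<^sup>2 + 3 * \<beta> * (b * s) + 2 * \<beta> * \<alpha> * (a * b) + 3 * \<beta>\<^sup>2 * b\<^sup>2
      \<le> - \<alpha> / 2 * a\<^sup>2 - \<beta> / 4 * b\<^sup>2 + 19 * \<alpha> * s\<^sup>2"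
  proof -
    have "\<alpha> * (a * s) \<le> \<alpha> * (a\<^sup>2 / 4 + s\<^sup>2)"
      using young_inequality[of "1/4" a s] \<open>0 < \<alpha>\<close> by (intro mult_left_mono) auto
    moreover have "\<beta> * (b * s) \<le> \<beta> * (b\<^sup>2 / 24 + 6 * s\<^sup>2)"
      using young_inequality[of "1/24" b s] \<beta> by (intro mult_left_mono) auto
    moreover have "\<beta> * s\<^sup>2 \<le> \<alpha> * s\<^sup>2"
      using \<beta> by (intro mult_right_mono) auto
    moreover have "\<alpha>\<^sup>2 * a\<^sup>2 \<le> \<alpha> * a\<^sup>2 / 16"
      using mult_right_mono[OF \<alpha>, of "\<alpha> * a\<^sup>2"] \<open>0 < \<alpha>\<close> by (simp add: power2_eq_square[of \<alpha>] mult_ac)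
    moreover have "\<beta>\<^sup>2 * b\<^sup>2 \<le> \<beta> * b\<^sup>2 / 16"
      using mult_right_mono[of \<beta> "1/16" "\<beta> * b\<^sup>2"] \<beta> \<alpha> by (simp add: power2_eq_square[of \<beta>] mult_ac)
    moreover have "2 * \<beta> * \<alpha> * (a * b) \<le> \<alpha> * a\<^sup>2 / 16 + \<beta> * b\<^sup>2 / 16"
    proof -
      have "2 * (a * b) \<le> a\<^sup>2 + b\<^sup>2"
        using sum_squares_bound[of a b] by simp
      then have "\<beta> * \<alpha> * (2 * (a * b)) \<le> \<beta> * \<alpha> * (a\<^sup>2 + b\<^sup>2)"
        using \<beta> \<open>0 < \<alpha>\<close> by (intro mult_left_mono) auto
      moreover have "\<beta> * (\<alpha> * a\<^sup>2) \<le> 1 / 16 * (\<alpha> * a\<^sup>2)" "\<alpha> * (\<beta> * b\<^sup>2) \<le> 1 / 16 * (\<beta> * b\<^sup>2)"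
        using \<beta> \<alpha> \<open>0 < \<alpha>\<close> by (intro mult_right_mono; simp)+
      ultimately show ?thesis
        by (simp add: algebra_simps)
    qed
    moreover have "0 \<le> \<alpha> * a\<^sup>2" "0 \<le> \<beta> * b\<^sup>2" "0 \<le> \<alpha> * s\<^sup>2"
      using \<beta> \<open>0 < \<alpha>\<close> by auto
    ultimately show ?thesis
      unfolding distrib_left by linarith
  qed
  then have "4 * L * (- \<alpha> * a\<^sup>2 + \<alpha>\<^sup>2 * a\<^sup>2 / 2 + \<alpha> * (a * s)
      - 3 / 4 * \<beta> * b\<^sup>2 + 3 * \<beta> * (b * s) + 2 * \<beta> * \<alpha> * (a * b) + 3 * \<beta>\<^sup>2 * b\<^sup>2
      + 16 / (3 * L) * (\<beta> * \<gamma>))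
    \<le> 4 * L * (- \<alpha> / 2 * a\<^sup>2 - \<beta> / 4 * b\<^sup>2 + 19 * \<alpha> * s\<^sup>2 + 16 / (3 * L) * (\<beta> * \<gamma>))"
    using L_pos by (intro mult_left_mono) auto
  then show ?thesis
    using 4 unfolding a_def b_def s_def by linarith
qed

text \<open>The step size \<open>\<beta>\<close> is chosen so that the Young-type bound \<open>powr_interpolation\<close> absorbs the
  duality gap into the quadratic descent, up to \<open>O(1 / T)\<close> per step.
  The weight is \<open>12138 = 578 * 21\<close>: the contraction factor \<open>577 / 578\<close> of \<open>E\<close> then pays for the
  \<open>19 * \<alpha>\<close> of \<open>U_step\<close>; and \<open>\<alpha>\<close> is small enough for the drift of \<open>u\<close>, which is
  quadratic in \<open>\<alpha>\<close> and \<open>\<beta>\<close>, to be absorbed.\<close>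

lemma potential_step:
  fixes x z :: 'a and y v :: 'b
  assumes w: "(x, y) \<in> X \<times> Y" "w' \<in> X \<times> Y" and p: "1 \<le> p" "p \<le> 2"
    and KL: "\<And>x y n. x \<in> X \<Longrightarrow> y \<in> Y \<Longrightarrow> n \<in> normal_cone X x \<Longrightarrow>
      f x y - min_x f X y \<le> M * norm (grad_x f x y + n) powr p"
    and "M \<ge> 0" and "T \<ge> 1" and \<alpha>: "\<alpha> = 1 / 100000"
    and b0: "0 < b0" "b0 \<le> \<alpha>"
      "16 * M / (3 * L) * b0 \<le> \<alpha> / 16" "16 * M / (3 * L) * b0 * (16 * L\<^sup>2) \<le> \<alpha> / 16"
    and VI: "\<And>q. q \<in> X \<times> Y \<Longrightarrow>
      ((x, y) - (1 / (576 * L)) *\<^sub>R (G (z, v) (x, y) + \<xi>) - w') \<bullet> (q - w') \<le> 0"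
  defines "\<beta> \<equiv> b0 * T powr (- (1 - p / 2))"
  defines "u \<equiv> (z, v)" and "u' \<equiv> (z + \<alpha> *\<^sub>R (x - z), v + \<beta> *\<^sub>R (y - v))"
  shows "U u' / (4 * L) + 12138 * \<alpha> * E u' w' (G u' w' - G u (x, y))
      + (\<alpha> / 4 * (norm (x - z))\<^sup>2 + \<beta> / 8 * (norm (y - v))\<^sup>2 + \<alpha> * E u (x, y) \<xi>)
    \<le> U u / (4 * L) + 12138 * \<alpha> * E u (x, y) \<xi> + \<alpha> / T"
proof -
  define a where "a = norm (x - z)"
  define b where "b = norm (y - v)"
  define s where "s = norm ((x, y) - saddle u)"
  define x1 where "x1 = fst (saddle u)"
  define y1 where "y1 = snd (saddle u)"
  define \<gamma> where "\<gamma> = f x1 y1 - min_x f X y1"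
  define Q where "Q = 4 * L * norm (x1 - z)"
  have "T powr (- (1 - p / 2)) \<le> T powr 0"
    using \<open>T \<ge> 1\<close> p by (intro powr_mono) auto
  then have "b0 * T powr (- (1 - p / 2)) \<le> b0 * 1"
    using b0 \<open>T \<ge> 1\<close> by (intro mult_left_mono) auto
  then have "\<beta> \<le> b0"
    by (simp only: \<beta>_def mult_1_right)
  moreover have "0 < \<beta>"
    using b0 \<open>T \<ge> 1\<close> by (simp add: \<beta>_def)
  ultimately have \<beta>: "0 < \<beta>" "\<beta> \<le> \<alpha>"
    using b0 by auto
  have x1: "x1 \<in> X" and y1: "y1 \<in> Y"
    by (auto simp: x1_def y1_def saddle_in)
  have "norm (x1 - x) \<le> s"
    unfolding s_def x1_def by (metis fst_conv fst_diff norm_fst_le norm_minus_commute prod.collapse)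
  then have "norm (x1 - z) \<le> s + a"
    using norm_triangle_ineq[of "x1 - x" "x - z"] by (simp add: a_def)
  then have "(norm (x1 - z))\<^sup>2 \<le> (s + a)\<^sup>2"
    by (intro power_mono) auto
  also have "\<dots> \<le> 2 * s\<^sup>2 + 2 * a\<^sup>2"
    using sum_squares_bound[of s a] by (simp add: power2_sum)
  finally have x1z: "(norm (x1 - z))\<^sup>2 \<le> 2 * s\<^sup>2 + 2 * a\<^sup>2" .
  \<comment> \<open>This is the normal vector supplied by the saddle point conditions; with it
    \<open>grad_x f x1 y1 + n\<close> reduces to the proximal term, so the gap is bounded by a power
    of \<open>norm (x1 - z)\<close>.\<close>
  define n where "n = - (grad_x f x1 y1 + (4 * L) *\<^sub>R (x1 - z))"
  have "n \<in> normal_cone X x1"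
    unfolding normal_cone_def
  proof (intro CollectI ballI)
    fix q assume "q \<in> X"
    then have "0 \<le> G u (saddle u) \<bullet> ((q, y1) - saddle u)"
      using saddle_solves_VI[of u] y1 by (auto simp: solves_VI_def)
    then show "n \<bullet> (q - x1) \<le> 0"
      by (cases "saddle u") (simp add: G_def H_def n_def x1_def y1_def u_def inner_prod_def
          inner_diff_left inner_add_left)
  qed
  then have "\<gamma> \<le> M * norm (grad_x f x1 y1 + n) powr p"
    unfolding \<gamma>_def by (intro KL x1 y1)
  also have "norm (grad_x f x1 y1 + n) = Q"
    using L_pos by (simp add: n_def Q_def)
  finally have "\<beta> * \<gamma> \<le> \<beta> * (M * Q powr p)"
    using \<beta> by (intro mult_left_mono) auto
  \<comment> \<open>\<open>\<beta>\<close> carries exactly the power of \<open>T\<close> that the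
    interpolation trades against \<open>Q powr p\<close>.\<close>
  also have "\<dots> = M * b0 * (T powr (- (1 - p / 2)) * Q powr p)"
    by (simp add: \<beta>_def)
  also have "\<dots> \<le> M * b0 * (Q\<^sup>2 + 1 / T)"
    using L_pos \<open>T \<ge> 1\<close> p \<open>M \<ge> 0\<close> b0
    by (intro mult_left_mono powr_interpolation) (auto simp: Q_def)
  finally have "16 / (3 * L) * (\<beta> * \<gamma>) \<le> 16 / (3 * L) * (M * b0 * (Q\<^sup>2 + 1 / T))"
    using L_pos by (intro mult_left_mono) auto
  also have "\<dots> = 16 * M / (3 * L) * b0 * (16 * L\<^sup>2) * (norm (x1 - z))\<^sup>2 + 16 * M / (3 * L) * b0 * (1 / T)"
    using L_pos by (simp add: Q_def power_mult_distrib distrib_left)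
  also have "\<dots> \<le> \<alpha> / 16 * (norm (x1 - z))\<^sup>2 + \<alpha> / 16 * (1 / T)"
    using b0 \<open>T \<ge> 1\<close> by (intro add_mono mult_right_mono) auto
  also have "\<dots> \<le> \<alpha> / 16 * (2 * s\<^sup>2 + 2 * a\<^sup>2) + \<alpha> / 16 * (1 / T)"
    using x1z \<alpha> by (intro add_right_mono mult_left_mono) auto
  finally have gap: "16 / (3 * L) * (\<beta> * \<gamma>) \<le> \<alpha> / 8 * s\<^sup>2 + \<alpha> / 8 * a\<^sup>2 + \<alpha> / 16 * (1 / T)"
    by (simp add: algebra_simps)
  have "U u' \<le> U u + 4 * L * (- \<alpha> / 2 * a\<^sup>2 - \<beta> / 4 * b\<^sup>2 + 19 * \<alpha> * s\<^sup>2 + 16 / (3 * L) * (\<beta> * \<gamma>))"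
    unfolding a_def b_def s_def \<gamma>_def x1_def y1_def u_def u'_def
    by (rule U_step) (use w \<beta> \<alpha> in auto)
  moreover have "q' / c \<le> q / c + k" if "q' \<le> q + c * k" "c > 0" for q q' c k :: real
    using that by (simp add: field_simps)
  ultimately have U: "U u' / (4 * L) \<le> U u / (4 * L)
      + (- \<alpha> / 2 * a\<^sup>2 - \<beta> / 4 * b\<^sup>2 + 19 * \<alpha> * s\<^sup>2 + 16 / (3 * L) * (\<beta> * \<gamma>))"
    using L_pos by simp
  have "E u' w' (G u' w' - G u (x, y)) \<le> 577 / 578 * E u (x, y) \<xi> + 2309 * (norm (u' - u))\<^sup>2"
    by (rule E_step) (use w VI in \<open>auto simp: u_def\<close>)
  also have "(norm (u' - u))\<^sup>2 = \<alpha>\<^sup>2 * a\<^sup>2 + \<beta>\<^sup>2 * b\<^sup>2"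
    by (simp add: u_def u'_def a_def b_def norm_Pair power_mult_distrib)
  finally have "12138 * \<alpha> * E u' w' (G u' w' - G u (x, y))
      \<le> 12138 * \<alpha> * (577 / 578 * E u (x, y) \<xi> + 2309 * (\<alpha>\<^sup>2 * a\<^sup>2 + \<beta>\<^sup>2 * b\<^sup>2))"
    by (rule mult_left_mono) (simp add: \<alpha>)
  \<comment> \<open>Here \<open>12138 * 577 / 578 = 12138 - 21\<close> and
    \<open>12138 * 2309 = 28026642\<close>. The 21 covers the 19 of \<open>U_step\<close>, the 1/8
    of \<open>gap\<close> and the 1 kept in the conclusion.\<close>
  also have "\<dots> = 12138 * \<alpha> * E u (x, y) \<xi> - 21 * \<alpha> * E u (x, y) \<xi>
      + 28026642 * (\<alpha> * (\<alpha>\<^sup>2 * a\<^sup>2)) + 28026642 * (\<alpha> * (\<beta>\<^sup>2 * b\<^sup>2))"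
    by (simp add: field_simps)
  finally have E: "12138 * \<alpha> * E u' w' (G u' w' - G u (x, y))
    \<le> 12138 * \<alpha> * E u (x, y) \<xi> - 21 * (\<alpha> * E u (x, y) \<xi>)
      + 28026642 * (\<alpha> * (\<alpha>\<^sup>2 * a\<^sup>2)) + 28026642 * (\<alpha> * (\<beta>\<^sup>2 * b\<^sup>2))"
    by simp
  have A: "28026642 * (\<alpha> * (\<alpha>\<^sup>2 * a\<^sup>2)) \<le> \<alpha> / 8 * a\<^sup>2"
    by (simp add: \<alpha> power2_eq_square)
  have "0 \<le> \<beta> * b\<^sup>2"
    using \<beta> by simp
  then have "28026642 * \<alpha> * (\<beta> * b\<^sup>2 * \<beta>) \<le> 28026642 * \<alpha> * (\<beta> * b\<^sup>2 * \<alpha>)"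
    using \<beta> by (intro mult_left_mono) auto
  also have "\<dots> = 28026642 / 10000000000 * (\<beta> * b\<^sup>2)"
    by (simp add: \<alpha>)
  also have "\<dots> \<le> 1 / 8 * (\<beta> * b\<^sup>2)"
    using \<open>0 \<le> \<beta> * b\<^sup>2\<close> by (intro mult_right_mono) auto
  finally have B: "28026642 * (\<alpha> * (\<beta>\<^sup>2 * b\<^sup>2)) \<le> \<beta> / 8 * b\<^sup>2"
    by (simp add: power2_eq_square[of \<beta>] mult_ac)
  have "s\<^sup>2 \<le> E u (x, y) \<xi>"
    by (simp add: E_def s_def)
  then have S: "\<alpha> * s\<^sup>2 \<le> \<alpha> * E u (x, y) \<xi>"
    using \<alpha> by (intro mult_left_mono) auto
  have "0 \<le> \<alpha> * s\<^sup>2" "0 \<le> \<alpha> / T" "0 \<le> \<alpha> * a\<^sup>2"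
    using \<alpha> \<open>T \<ge> 1\<close> by auto
  \<comment> \<open>For \<open>\<alpha> * a^2\<close> the balance is 1/2 - 1/8 (\<open>gap\<close>)
    - 1/8 (\<open>A\<close>) = 1/4; for \<open>\<beta> * b^2\<close> it is 1/4 - 1/8
    (\<open>B\<close>) = 1/8.\<close>
  then show ?thesis
    using U E A B S gap unfolding a_def[symmetric] b_def[symmetric] by (simp add: algebra_simps)
qed

text \<open>The projection residual, divided by the step size, is a normal vector \<open>n\<close>
  at the new point. What remains of \<open>H w' + n\<close> consists of the step length, the
  distance to the proximal centre and \<open>\<xi>\<close>, each of order \<open>R\<close>. The
  constants 2 * 578 + 2 * 4 + 20 stay below 1200.\<close>

lemma stationarity_le:
  fixes x z :: 'a and y v :: 'b
  assumes w: "(x, y) \<in> X \<times> Y" "(x', y') \<in> X \<times> Y"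
    and VI: "\<And>q. q \<in> X \<times> Y \<Longrightarrow>
      ((x, y) - (1 / (576 * L)) *\<^sub>R (G (z, v) (x, y) + \<xi>) - (x', y')) \<bullet> (q - (x', y')) \<le> 0"
    and R: "E (z, v) (x, y) \<xi> \<le> R\<^sup>2" "norm (x - z) \<le> R" "norm (y - v) \<le> R"
  shows "game_stationary f X Y (1200 * L * R) x' y'"
proof -
  define w where "w = (x, y)"
  define w' where "w' = (x', y')"
  define u where "u = (z, v)"
  have "0 \<le> R"
    using R(2) norm_ge_zero order_trans by blast
  define n where "n = (576 * L) *\<^sub>R (w - w') - (G u w + \<xi>)"
  have n: "n = (576 * L) *\<^sub>R (w - (1 / (576 * L)) *\<^sub>R (G u w + \<xi>) - w')"
    using L_pos by (simp add: n_def algebra_simps)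
  have nc: "n \<bullet> (q - w') \<le> 0" if "q \<in> X \<times> Y" for q
    using VI[OF that] L_pos unfolding n inner_scaleR_left
    by (simp add: mult_le_0_iff w_def w'_def u_def)
  have "H w' + n = (H w' - H w) + ((576 * L) *\<^sub>R (w - w') - (4 * L) *\<^sub>R (w - u) - \<xi>)"
    by (simp add: n_def G_def algebra_simps)
  also have "norm \<dots> \<le> norm (H w' - H w) + (norm ((576 * L) *\<^sub>R (w - w')) + norm ((4 * L) *\<^sub>R (w - u)) + norm \<xi>)"
    by (intro order_trans[OF norm_triangle_ineq] add_left_mono order_trans[OF norm_triangle_ineq4]
        add_right_mono order_refl)
  also have "\<dots> \<le> 578 * L * norm (w' - w) + 4 * L * norm (w - u) + norm \<xi>"
    using H_lipschitz[OF w(2,1), folded w_def w'_def] L_pos by (simp add: norm_minus_commute[of w w'])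
  also have "\<dots> \<le> 578 * L * (2 * R) + 4 * L * (2 * R) + 20 * L * R"
  proof -
    have "(norm (w' - w))\<^sup>2 \<le> 2 * E u w \<xi>"
      unfolding w_def w'_def u_def by (rule step_length_le) (use w VI in auto)
    also have "\<dots> \<le> (2 * R)\<^sup>2"
      using order_trans[OF R(1), of "2 * R\<^sup>2"] by (simp add: w_def u_def power_mult_distrib)
    finally have 1: "norm (w' - w) \<le> 2 * R"
      by (rule power2_le_imp_le) (use \<open>0 \<le> R\<close> in simp)
    have 2: "norm (w - u) \<le> 2 * R"
      using norm_Pair_le[of "x - z" "y - v"] R by (simp add: w_def u_def)
    have "(norm \<xi>)\<^sup>2 / (288 * L\<^sup>2) \<le> R\<^sup>2"
      using R(1) by (auto simp: E_def intro: order_trans[rotated])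
    then have "(norm \<xi>)\<^sup>2 \<le> 288 * (L * R)\<^sup>2"
      using L_pos by (simp add: divide_le_eq power_mult_distrib mult_ac)
    also have "\<dots> \<le> 400 * (L * R)\<^sup>2"
      by (intro mult_right_mono) auto
    also have "\<dots> = (20 * L * R)\<^sup>2"
      by (simp add: power_mult_distrib)
    finally have "(norm \<xi>)\<^sup>2 \<le> (20 * L * R)\<^sup>2" .
    then have 3: "norm \<xi> \<le> 20 * L * R"
      by (rule power2_le_imp_le) (use \<open>0 \<le> R\<close> L_pos in simp)
    show ?thesis
      using 1 2 3 L_pos by (intro add_mono mult_left_mono) auto
  qed
  also have "\<dots> \<le> 1200 * L * R"
    using L_pos \<open>0 \<le> R\<close> by simp
  finally have bound: "norm (H w' + n) \<le> 1200 * L * R" .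
  \<comment> \<open>Test points sharing one component with \<open>w'\<close> split the normal vector
    of the product set.\<close>
  have "fst n \<in> normal_cone X x'" "snd n \<in> normal_cone Y y'"
    using nc[of "(_, y')"] nc[of "(x', _)"] w
    by (auto simp: normal_cone_def inner_prod_def w'_def)
  then have "infdist 0 ((\<lambda>n. grad_x f x' y' + n) ` normal_cone X x') \<le> dist 0 (grad_x f x' y' + fst n)"
    "infdist 0 ((\<lambda>n. - grad_y f x' y' + n) ` normal_cone Y y') \<le> dist 0 (- grad_y f x' y' + snd n)"
    by - (rule infdist_le[OF imageI], assumption)+
  moreover have "norm (grad_x f x' y' + fst n) \<le> norm (H w' + n)" "norm (- grad_y f x' y' + snd n) \<le> norm (H w' + n)"
  proof -
    have "H w' + n = (grad_x f x' y' + fst n, - grad_y f x' y' + snd n)"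
      by (simp add: H_def w'_def prod_eq_iff)
    then show "norm (grad_x f x' y' + fst n) \<le> norm (H w' + n)" "norm (- grad_y f x' y' + snd n) \<le> norm (H w' + n)"
      by (metis norm_fst_le, metis norm_snd_le)
  qed
  ultimately show ?thesis
    using w bound unfolding game_stationary_def dist_0_norm by auto
qed

section \<open>The algorithm as an optimistic step for \<open>G\<close>, and its rate\<close>

lemma G_x_eq: "G_x f (4 * L) (4 * L) (x, y, z, v) = fst (G (z, v) (x, y))"
proof -
  have "GDERIV (\<lambda>u. smoothed f (4 * L) (4 * L) u y z v) x :> grad_x f x y + (4 * L) *\<^sub>R (x - z) - 0"
    unfolding smoothed_def by (intro GDERIV_diff GDERIV_add deriv_x GDERIV_half_norm_square GDERIV_const)
  then show ?thesis
    by (simp add: G_x_def G_def H_def grad_eqI)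
qed

lemma G_y_eq: "G_y f (4 * L) (4 * L) (x, y, z, v) = snd (G (z, v) (x, y))"
proof -
  have "GDERIV (\<lambda>w. smoothed f (4 * L) (4 * L) x w z v) y :> grad_y f x y + 0 - (4 * L) *\<^sub>R (y - v)"
    unfolding smoothed_def by (intro GDERIV_diff GDERIV_add deriv_y GDERIV_half_norm_square GDERIV_const)
  then show ?thesis
    by (simp add: G_y_def G_def H_def grad_eqI)
qed

text \<open>Both cases are instances of this rate, through the exponent \<open>p\<close> of the gap
  bound. Summing the potential decrease yields an index where the decrease is
  \<open>O(1 / T)\<close>. The weight \<open>\<beta>\<close> of \<open>norm (y - v)\<close> in it
  degrades the squared residual to \<open>T powr - (p / 2)\<close>, whose root gives the exponent
  \<open>p / 4\<close>.\<close>

lemma dsogda_rate: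
  assumes x0: "x\<^sub>0 \<in> X" and y0: "y\<^sub>0 \<in> Y" and p: "1 \<le> p" "p \<le> 2"
    and KL: "\<And>x y n. x \<in> X \<Longrightarrow> y \<in> Y \<Longrightarrow> n \<in> normal_cone X x \<Longrightarrow>
      f x y - min_x f X y \<le> M * norm (grad_x f x y + n) powr p"
  shows "\<exists>K B C. \<forall>T::nat. T > 1 \<longrightarrow>
    (\<exists>r\<^sub>x r\<^sub>y \<eta>\<^sub>x \<eta>\<^sub>y \<beta>\<^sub>x \<beta>\<^sub>y.
      0 < r\<^sub>x \<and> r\<^sub>x \<le> K \<and> 0 < r\<^sub>y \<and> r\<^sub>y \<le> K \<and>
      0 < \<eta>\<^sub>x \<and> \<eta>\<^sub>x \<le> K \<and> 0 < \<eta>\<^sub>y \<and> \<eta>\<^sub>y \<le> K \<and>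
      0 < \<beta>\<^sub>x \<and> \<beta>\<^sub>x < 1 \<and> 0 < \<beta>\<^sub>y \<and> \<beta>\<^sub>y < 1 \<and>
      \<beta>\<^sub>y \<le> B * real T powr (- (1 - p / 2)) \<and>
      (\<exists>t<T. game_stationary f X Y (C * real T powr (- (p / 4)))
        (dsogda_x f X Y r\<^sub>x r\<^sub>y \<eta>\<^sub>x \<eta>\<^sub>y \<beta>\<^sub>x \<beta>\<^sub>y x\<^sub>0 y\<^sub>0 (t + 1))
        (dsogda_y f X Y r\<^sub>x r\<^sub>y \<eta>\<^sub>x \<eta>\<^sub>y \<beta>\<^sub>x \<beta>\<^sub>y x\<^sub>0 y\<^sub>0 (t + 1))))"
proof -
  define M' where "M' = max M 0"
  have "M' \<ge> 0"
    by (simp add: M'_def)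
  have KL': "f x y - min_x f X y \<le> M' * norm (grad_x f x y + n) powr p"
    if "x \<in> X" "y \<in> Y" "n \<in> normal_cone X x" for x y n
  proof -
    have "M * norm (grad_x f x y + n) powr p \<le> M' * norm (grad_x f x y + n) powr p"
      by (intro mult_right_mono) (auto simp: M'_def)
    then show ?thesis
      using KL[OF that] by linarith
  qed
  obtain B where B: "\<And>y. y \<in> Y \<Longrightarrow> min_x f X y \<le> B"
    using bdd_min_x by (auto simp: bdd_above_def)
  define \<alpha> :: real where "\<alpha> = 1 / 100000"
  \<comment> \<open>\<open>N * b0\<close> is the sum of the two quantities that
    \<open>potential_step\<close> requires to be at most \<open>\<alpha> / 16\<close>.\<close>
  define N where "N = 16 * M' / (3 * L) * (16 * L\<^sup>2 + 1)"
  have "N \<ge> 0"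
    using L_pos \<open>M' \<ge> 0\<close> by (simp add: N_def)
  define b0 where "b0 = \<alpha> / (16 * (N + 1))"
  have b0: "0 < b0" "b0 \<le> \<alpha>"
    using \<open>N \<ge> 0\<close> by (auto simp: b0_def \<alpha>_def divide_simps)
  have "N * b0 \<le> \<alpha> / 16"
    using \<open>N \<ge> 0\<close> by (simp add: b0_def \<alpha>_def divide_simps)
  moreover have "16 * M' / (3 * L) * b0 * (16 * L\<^sup>2) + 16 * M' / (3 * L) * b0 = N * b0"
    by (simp add: N_def algebra_simps add_divide_distrib)
  moreover have "0 \<le> 16 * M' / (3 * L) * b0 * (16 * L\<^sup>2)" "0 \<le> 16 * M' / (3 * L) * b0"
    using b0 \<open>M' \<ge> 0\<close> L_pos by auto
  ultimately have b0': "16 * M' / (3 * L) * b0 \<le> \<alpha> / 16" "16 * M' / (3 * L) * b0 * (16 * L\<^sup>2) \<le> \<alpha> / 16"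
    by linarith+
  define w0 where "w0 = (x\<^sub>0, y\<^sub>0)"
  \<comment> \<open>Initial potential, plus the total \<open>\<alpha>\<close> of \<open>T\<close>
    errors \<open>\<alpha> / T\<close>, minus the lower bound \<open>- B / (4 * L)\<close> of the
    final potential.\<close>
  define C0 where "C0 = U w0 / (4 * L) + 12138 * \<alpha> * E w0 w0 0 + \<alpha> + B / (4 * L)"
  define R0 where "R0 = sqrt (8 * C0 / b0)"
  define \<eta> where "\<eta> = 1 / (576 * L)"
  have "\<eta> > 0"
    using L_pos by (simp add: \<eta>_def)
  have main: "\<exists>t<T. game_stationary f X Y (1200 * L * R0 * real T powr (- (p / 4)))
      (dsogda_x f X Y (4 * L) (4 * L) \<eta> \<eta> \<alpha> (b0 * real T powr (- (1 - p / 2))) x\<^sub>0 y\<^sub>0 (t + 1))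
      (dsogda_y f X Y (4 * L) (4 * L) \<eta> \<eta> \<alpha> (b0 * real T powr (- (1 - p / 2))) x\<^sub>0 y\<^sub>0 (t + 1))"
    if "T > 1" for T :: nat
  proof -
    define \<beta> where "\<beta> = b0 * real T powr (- (1 - p / 2))"
    define pair where "pair = dsogda_pair f X Y (4 * L) (4 * L) \<eta> \<eta> \<alpha> \<beta> x\<^sub>0 y\<^sub>0"
    define x where "x t = fst (snd (pair t))" for t
    define y where "y t = fst (snd (snd (pair t)))" for t
    define z where "z t = fst (snd (snd (snd (pair t))))" for t
    define v where "v t = snd (snd (snd (snd (pair t))))" for t
    define g where "g t = G (z t, v t) (x t, y t)" for t
    \<comment> \<open>Truncated subtraction gives \<open>\<xi> 0 = 0\<close>, matching the
      convention that the states at times -1 and 0 coincide.\<close>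
    define \<xi> where "\<xi> t = g t - g (t - 1)" for t
    have state: "snd (pair t) = (x t, y t, z t, v t)" for t
      by (simp add: x_def y_def z_def v_def)
    have prev: "fst (pair t) = (x (t - 1), y (t - 1), z (t - 1), v (t - 1))" for t
      unfolding state[symmetric] by (cases t) (simp_all add: pair_def split_beta)
    have step: "snd (pair (Suc t)) = dsogda_step f X Y (4 * L) (4 * L) \<eta> \<eta> \<alpha> \<beta> (fst (pair t)) (snd (pair t))" for t
      by (simp add: pair_def split_beta)
    have start: "x 0 = x\<^sub>0" "y 0 = y\<^sub>0" "z 0 = x\<^sub>0" "v 0 = y\<^sub>0"
      by (simp_all add: x_def y_def z_def v_def pair_def)
    have xS: "x (Suc t) = closest_point X (x t - \<eta> *\<^sub>R fst (g t) + \<eta> *\<^sub>R (fst (g (t - 1)) - fst (g t)))"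
      and yS: "y (Suc t) = closest_point Y (y t - \<eta> *\<^sub>R snd (g t) + \<eta> *\<^sub>R (snd (g (t - 1)) - snd (g t)))"
      and zS: "z (Suc t) = z t + \<alpha> *\<^sub>R (x t - z t)"
      and vS: "v (Suc t) = v t + \<beta> *\<^sub>R (y t - v t)" for t
      using step[of t] unfolding state prev dsogda_step_def by (simp_all add: G_x_eq G_y_eq g_def)
    have closed: "closed X"
      using X by (simp add: compact_imp_closed)
    have xy: "x t \<in> X" "y t \<in> Y" for t
      by (cases t; simp add: start xS yS x0 y0 closest_point_in_set closed X Y)+
    have VI: "((x t, y t) - (1 / (576 * L)) *\<^sub>R (g t + \<xi> t) - (x (Suc t), y (Suc t))) \<bullet> (q - (x (Suc t), y (Suc t))) \<le> 0"
      if q': "q \<in> X \<times> Y" for q t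
    proof -
      obtain a b where q: "q = (a, b)" "a \<in> X" "b \<in> Y"
        using q' by auto
      have "(x t - \<eta> *\<^sub>R fst (g t) + \<eta> *\<^sub>R (fst (g (t - 1)) - fst (g t)) - x (Suc t)) \<bullet> (a - x (Suc t)) \<le> 0"
        unfolding xS by (intro closest_point_dot closed X q)
      moreover have "(y t - \<eta> *\<^sub>R snd (g t) + \<eta> *\<^sub>R (snd (g (t - 1)) - snd (g t)) - y (Suc t)) \<bullet> (b - y (Suc t)) \<le> 0"
        unfolding yS by (intro closest_point_dot Y q)
      moreover have "(x t, y t) - (1 / (576 * L)) *\<^sub>R (g t + \<xi> t) - (x (Suc t), y (Suc t))
        = (x t - \<eta> *\<^sub>R fst (g t) + \<eta> *\<^sub>R (fst (g (t - 1)) - fst (g t)) - x (Suc t),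
           y t - \<eta> *\<^sub>R snd (g t) + \<eta> *\<^sub>R (snd (g (t - 1)) - snd (g t)) - y (Suc t))"
        unfolding \<xi>_def \<eta>_def[symmetric] by (simp add: prod_eq_iff algebra_simps)
      ultimately show ?thesis
        by (simp add: q inner_prod_def)
    qed
    define V where "V t = U (z t, v t) / (4 * L) + 12138 * \<alpha> * E (z t, v t) (x t, y t) (\<xi> t)" for t
    define m where "m t = \<alpha> / 4 * (norm (x t - z t))\<^sup>2 + \<beta> / 8 * (norm (y t - v t))\<^sup>2
        + \<alpha> * E (z t, v t) (x t, y t) (\<xi> t)" for t
    have descent: "V (Suc t) + m t \<le> V t + \<alpha> / real T" for t
      using potential_step[of "x t" "y t" "(x (Suc t), y (Suc t))" p M' "real T" \<alpha> b0 "z t" "v t" "\<xi> t"]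
        xy KL' \<open>M' \<ge> 0\<close> p that b0 b0' VI[of _ t, unfolded g_def]
      by (simp add: V_def m_def \<alpha>_def zS[unfolded \<alpha>_def] vS \<beta>_def \<xi>_def g_def)
    have sum: "V k + (\<Sum>t<k. m t) \<le> V 0 + real k * (\<alpha> / real T)" for k
    proof (induction k)
      case (Suc k)
      then show ?case
        using descent[of k] by (simp add: distrib_right add_divide_distrib)
    qed simp
    have "- B / (4 * L) \<le> U (z T, v T) / (4 * L)"
      using U_lower[OF B] L_pos by (intro divide_right_mono) auto
    then have "- B / (4 * L) \<le> V T"
      using E_nonneg[of "(z T, v T)" "(x T, y T)" "\<xi> T"] by (simp add: V_def \<alpha>_def)
    moreover have "V 0 = U w0 / (4 * L) + 12138 * \<alpha> * E w0 w0 0"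
      by (simp add: V_def start \<xi>_def w0_def)
    ultimately have sum_m: "(\<Sum>t<T. m t) \<le> C0"
      using sum[of T] that by (simp add: C0_def)
    have "\<exists>t<T. m t \<le> C0 / real T"
    proof (rule ccontr)
      assume "\<not> ?thesis"
      then have "(\<Sum>t<T. C0 / real T) < (\<Sum>t<T. m t)"
        using that by (intro sum_strict_mono) (auto simp: not_le)
      then show False
        using sum_m that by simp
    qed
    then obtain t where t: "t < T" "m t \<le> C0 / real T"
      by blast
    have \<beta>: "0 < \<beta>"
      using b0 that by (simp add: \<beta>_def)
    have nonneg: "0 \<le> \<alpha> / 4 * (norm (x t - z t))\<^sup>2" "0 \<le> \<beta> / 8 * (norm (y t - v t))\<^sup>2"
      "0 \<le> \<alpha> * E (z t, v t) (x t, y t) (\<xi> t)"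
      using \<beta> by (auto simp: \<alpha>_def E_nonneg)
    then have m: "\<alpha> / 4 * (norm (x t - z t))\<^sup>2 \<le> C0 / real T"
      "\<beta> / 8 * (norm (y t - v t))\<^sup>2 \<le> C0 / real T"
      "\<alpha> * E (z t, v t) (x t, y t) (\<xi> t) \<le> C0 / real T"
      using t(2) unfolding m_def by linarith+
    then have "0 \<le> C0 / real T"
      using nonneg by linarith
    then have "0 \<le> C0"
      using that by (simp add: zero_le_divide_iff)
    \<comment> \<open>As \<open>p \<le> 2\<close>, the terms with weights independent of
      \<open>T\<close> decay at least as fast as required.\<close>
    have Tp: "1 / real T \<le> real T powr (- (p / 2))"
      using powr_mono[of "-1" "- (p / 2)" "real T"] p that by (simp add: powr_neg_one)
    define \<rho> where "\<rho> = 8 * C0 / b0 * real T powr (- (p / 2))"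
    have small: "q \<le> \<rho>" if "c * q \<le> C0 / real T" "b0 / 8 \<le> c" "0 \<le> q" for c q
    proof -
      have "b0 / 8 * q \<le> c * q"
        using that by (intro mult_right_mono)
      also have "\<dots> \<le> C0 * (1 / real T)"
        using that by simp
      also have "\<dots> \<le> C0 * real T powr (- (p / 2))"
        by (intro mult_left_mono Tp \<open>0 \<le> C0\<close>)
      finally show ?thesis
        using b0 by (simp add: \<rho>_def field_simps)
    qed
    have "(norm (x t - z t))\<^sup>2 \<le> \<rho>"
      by (rule small[of "\<alpha> / 4"]) (use m b0 in auto)
    moreover have E: "E (z t, v t) (x t, y t) (\<xi> t) \<le> \<rho>"
      by (rule small[of \<alpha>]) (use m b0 in \<open>auto simp: E_nonneg\<close>)
    \<comment> \<open>The weight \<open>\<beta> / 8\<close> shrinks with \<open>T\<close>; dividing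
      it out of \<open>1 / T\<close> leaves \<open>T powr - (p / 2)\<close>.\<close>
    moreover have "(norm (y t - v t))\<^sup>2 \<le> \<rho>"
    proof -
      have "\<beta> / 8 * (norm (y t - v t))\<^sup>2 \<le> C0 * (1 / real T)"
        using m by simp
      also have "1 / real T = real T powr (- (1 - p / 2)) * real T powr (- (p / 2))"
        unfolding powr_add[symmetric] using that by (simp add: powr_neg_one)
      finally have "real T powr (- (1 - p / 2)) * (b0 * (norm (y t - v t))\<^sup>2)
          \<le> real T powr (- (1 - p / 2)) * (8 * C0 * real T powr (- (p / 2)))"
        by (simp add: \<beta>_def mult_ac)
      then have "b0 * (norm (y t - v t))\<^sup>2 \<le> 8 * C0 * real T powr (- (p / 2))"
        using that by (subst (asm) mult_le_cancel_left_pos) auto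
      then show ?thesis
        using b0 by (simp add: \<rho>_def field_simps)
    qed
    moreover have \<rho>: "\<rho> = (R0 * real T powr (- (p / 4)))\<^sup>2"
    proof -
      have "(real T powr (- (p / 4)))\<^sup>2 = real T powr (- (p / 2))"
        unfolding power2_eq_square powr_add[symmetric] by simp
      moreover have "R0\<^sup>2 = 8 * C0 / b0"
        using b0 \<open>0 \<le> C0\<close> by (simp add: R0_def)
      ultimately show ?thesis
        by (simp add: \<rho>_def power_mult_distrib)
    qed
    moreover have "0 \<le> R0 * real T powr (- (p / 4))"
      using b0 \<open>0 \<le> C0\<close> by (simp add: R0_def)
    ultimately have "game_stationary f X Y (1200 * L * (R0 * real T powr (- (p / 4)))) (x (Suc t)) (y (Suc t))"
      by (intro stationarity_le[of "x t" "y t" _ _ "z t" "v t" "\<xi> t"])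
        (use xy VI[of _ t, unfolded g_def] in \<open>auto intro: power2_le_imp_le\<close>)
    then show ?thesis
      using t(1) by (auto simp: x_def y_def pair_def dsogda_x_def dsogda_y_def \<beta>_def mult.assoc)
  qed
  show ?thesis
  \<comment> \<open>The witnesses are read off from the shown goal:
    \<open>K = max (4 * L) \<eta>\<close>, \<open>B = b0\<close> and
    \<open>C = 1200 * L * R0\<close>, all independent of \<open>T\<close>.\<close>
  proof (intro exI allI impI)
    fix T :: nat
    assume T: "T > 1"
    have "real T powr (- (1 - p / 2)) \<le> real T powr 0"
      using T p by (intro powr_mono) auto
    then have "b0 * real T powr (- (1 - p / 2)) \<le> b0 * 1"
      using b0 T by (intro mult_left_mono) auto
    also have "b0 * 1 < 1"
      using b0 by (simp add: \<alpha>_def)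
    finally have "b0 * real T powr (- (1 - p / 2)) < 1" .
    then show "0 < 4 * L \<and> 4 * L \<le> max (4 * L) \<eta> \<and> 0 < 4 * L \<and> 4 * L \<le> max (4 * L) \<eta> \<and>
      0 < \<eta> \<and> \<eta> \<le> max (4 * L) \<eta> \<and> 0 < \<eta> \<and> \<eta> \<le> max (4 * L) \<eta> \<and>
      0 < \<alpha> \<and> \<alpha> < 1 \<and> 0 < b0 * real T powr (- (1 - p / 2)) \<and> b0 * real T powr (- (1 - p / 2)) < 1 \<and>
      b0 * real T powr (- (1 - p / 2)) \<le> b0 * real T powr (- (1 - p / 2)) \<and>
      (\<exists>t<T. game_stationary f X Y (1200 * L * R0 * real T powr (- (p / 4)))
        (dsogda_x f X Y (4 * L) (4 * L) \<eta> \<eta> \<alpha> (b0 * real T powr (- (1 - p / 2))) x\<^sub>0 y\<^sub>0 (t + 1))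
        (dsogda_y f X Y (4 * L) (4 * L) \<eta> \<eta> \<alpha> (b0 * real T powr (- (1 - p / 2))) x\<^sub>0 y\<^sub>0 (t + 1)))"
      using main[OF T] L_pos \<open>\<eta> > 0\<close> b0 T by (auto simp: \<alpha>_def)
  qed
qed

end

section \<open>The convex and the KL case\<close>

lemma smooth_minimaxI:
  fixes f :: "'a::euclidean_space \<Rightarrow> 'b::euclidean_space \<Rightarrow> real"
  assumes "X \<noteq> {}" "compact X" "convex X" "Y \<noteq> {}" "closed Y" "convex Y"
    and f: "continuously_differentiable (\<lambda>(x, y). f x y)"
    and "L > 0" "lipschitz_partial_gradients f X Y L" "bdd_above (min_x f X ` Y)"
  shows "smooth_minimax f X Y L"
proof
  fix x :: 'a and y :: 'b
  obtain f' where f': "((\<lambda>(x, y). f x y) has_derivative f') (at (x, y))"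
    using f by (auto simp: continuously_differentiable_def differentiable_def)
  have "((\<lambda>u. (u, y)) has_derivative (\<lambda>h. (h, 0))) (at x)"
    "((\<lambda>w. (x, w)) has_derivative (\<lambda>h. (0, h))) (at y)"
    by (auto intro!: derivative_eq_intros)
  then have "(\<lambda>u. f u y) differentiable (at x)" "(\<lambda>w. f x w) differentiable (at y)"
    using has_derivative_compose[where f = "\<lambda>u. (u, y)" and s = UNIV, OF _ f']
      has_derivative_compose[where f = "\<lambda>w. (x, w)" and s = UNIV, OF _ f']
    unfolding differentiable_def by auto
  then show "GDERIV (\<lambda>u. f u y) x :> grad_x f x y" "GDERIV (\<lambda>w. f x w) y :> grad_y f x y"
    unfolding grad_x_def grad_y_def by (auto intro: GDERIV_grad)
qed (use assms in auto)

text \<open>In the gradient inequality, adding a normal vector \<open>n\<close> only lowers the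
  linear term on \<open>X\<close>; Cauchy-Schwarz and the diameter do the rest.\<close>

lemma (in smooth_minimax) convex_gap_le:
  assumes "convex_on X (\<lambda>x. f x y)" and x: "x \<in> X" and n: "n \<in> normal_cone X x"
  shows "f x y - min_x f X y \<le> diameter X * norm (grad_x f x y + n)"
proof -
  have "f x y - diameter X * norm (grad_x f x y + n) \<le> min_x f X y"
    unfolding min_x_def
  proof (rule cINF_greatest)
    fix x' assume x': "x' \<in> X"
    have "f x' y \<ge> f x y + grad_x f x y \<bullet> (x' - x)"
      by (rule convex_on_gradient_inequality[OF assms(1) x x' deriv_x])
    moreover have "n \<bullet> (x' - x) \<le> 0"
      using n x' by (simp add: normal_cone_def)
    moreover have "- ((grad_x f x y + n) \<bullet> (x' - x)) \<le> norm (grad_x f x y + n) * norm (x' - x)"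
      using Cauchy_Schwarz_ineq2[of "grad_x f x y + n" "x' - x"] by linarith
    moreover have "norm (x' - x) \<le> diameter X"
      using diameter_bounded_bound[of X x' x] X x x' by (simp add: compact_imp_bounded dist_norm)
    then have "norm (grad_x f x y + n) * norm (x' - x) \<le> norm (grad_x f x y + n) * diameter X"
      by (rule mult_left_mono) simp
    ultimately show "f x y - diameter X * norm (grad_x f x y + n) \<le> f x' y"
      by (simp add: inner_add_left mult.commute)
  qed (rule X)
  then show ?thesis
    by simp
qed

text \<open>KL bounds the gap with power \<open>1 / \<theta>\<close> of the residual, while the rate
  lemma admits powers up to 2. The uniform bound \<open>B\<close> on the gap allows the smaller
  power \<open>p\<close>, by splitting the gap as \<open>\<delta> powr (1 - p * \<theta>) *
  (\<delta> powr \<theta>) powr p\<close>.\<close>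

lemma (in smooth_minimax) KL_gap_le:
  assumes KL: "primal_KL f X Y \<theta>" and \<theta>: "\<theta> > 0" and p: "0 \<le> p" "p * \<theta> \<le> 1"
    and gap: "\<And>x y. x \<in> X \<Longrightarrow> y \<in> Y \<Longrightarrow> f x y - min_x f X y \<le> B"
  obtains M where "\<And>x y n. x \<in> X \<Longrightarrow> y \<in> Y \<Longrightarrow> n \<in> normal_cone X x \<Longrightarrow>
    f x y - min_x f X y \<le> M * norm (grad_x f x y + n) powr p"
proof -
  obtain \<tau> where "\<tau> > 0" and \<tau>: "\<And>x y. x \<in> X \<Longrightarrow> y \<in> Y \<Longrightarrow>
      (f x y - min_x f X y) powr \<theta>
        \<le> (1 / \<tau>) * infdist 0 ((\<lambda>n. grad_x f x y + n) ` normal_cone X x)"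
    using KL by (auto simp: primal_KL_def)
  have "f x y - min_x f X y \<le> B powr (1 - p * \<theta>) * (1 / \<tau>) powr p * norm (grad_x f x y + n) powr p"
    if "x \<in> X" "y \<in> Y" "n \<in> normal_cone X x" for x y n
  proof -
    define \<delta> where "\<delta> = f x y - min_x f X y"
    have \<delta>: "0 \<le> \<delta>" "\<delta> \<le> B"
      using min_x_le[OF that(1), of y] gap that by (auto simp: \<delta>_def)
    have "infdist 0 ((\<lambda>n. grad_x f x y + n) ` normal_cone X x) \<le> norm (grad_x f x y + n)"
      using infdist_le[of "grad_x f x y + n" _ 0] that by (simp add: dist_0_norm)
    then have "(1 / \<tau>) * infdist 0 ((\<lambda>n. grad_x f x y + n) ` normal_cone X x)
        \<le> (1 / \<tau>) * norm (grad_x f x y + n)"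
      using \<open>\<tau> > 0\<close> by (intro mult_left_mono) auto
    then have "\<delta> powr \<theta> \<le> (1 / \<tau>) * norm (grad_x f x y + n)"
      using \<tau>[OF that(1,2)] unfolding \<delta>_def by linarith
    then have "(\<delta> powr \<theta>) powr p \<le> ((1 / \<tau>) * norm (grad_x f x y + n)) powr p"
      using p by (intro powr_mono2) auto
    also have "\<dots> = (1 / \<tau>) powr p * norm (grad_x f x y + n) powr p"
      by (rule powr_mult)
    finally have 1: "(\<delta> powr \<theta>) powr p \<le> (1 / \<tau>) powr p * norm (grad_x f x y + n) powr p" .
    \<comment> \<open>For \<open>\<delta> = 0\<close> this holds because \<open>0 powr _\<close> is
      0 for every exponent.\<close>
    have "\<delta> = \<delta> powr (1 - p * \<theta>) * (\<delta> powr \<theta>) powr p"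
      using \<delta> by (cases "\<delta> = 0") (simp_all add: powr_powr mult.commute flip: powr_add)
    also have "\<dots> \<le> B powr (1 - p * \<theta>) * ((1 / \<tau>) powr p * norm (grad_x f x y + n) powr p)"
      using 1 \<delta> p by (intro mult_mono powr_mono2) auto
    finally show ?thesis
      by (simp add: \<delta>_def mult.assoc)
  qed
  then show thesis
    by (rule that)
qed

theorem corollary2p1:
  fixes f :: "real ^ 'n \<Rightarrow> real ^ 'd \<Rightarrow> real"
    and X :: "(real ^ 'n) set" and Y :: "(real ^ 'd) set"
    and L :: real and x\<^sub>0 :: "real ^ 'n" and y\<^sub>0 :: "real ^ 'd"
  assumes "X \<noteq> {}" and "compact X" and "convex X"
    and "Y \<noteq> {}" and "closed Y" and "convex Y"
    and "continuously_differentiable (\<lambda>(x, y). f x y)"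
    and "L \<ge> 1" and "lipschitz_partial_gradients f X Y L"
    and "x\<^sub>0 \<in> X" and "y\<^sub>0 \<in> Y"
  shows
    "((\<forall>y\<in>Y. convex_on X (\<lambda>x. f x y)) \<and> bdd_above (min_x f X ` Y) \<longrightarrow>
       (\<exists>K B C. \<forall>T::nat. T > 1 \<longrightarrow>
         (\<exists>r\<^sub>x r\<^sub>y \<eta>\<^sub>x \<eta>\<^sub>y \<beta>\<^sub>x \<beta>\<^sub>y.
            0 < r\<^sub>x \<and> r\<^sub>x \<le> K \<and> 0 < r\<^sub>y \<and> r\<^sub>y \<le> K \<and>
            0 < \<eta>\<^sub>x \<and> \<eta>\<^sub>x \<le> K \<and> 0 < \<eta>\<^sub>y \<and> \<eta>\<^sub>y \<le> K \<and>
            0 < \<beta>\<^sub>x \<and> \<beta>\<^sub>x < 1 \<and> 0 < \<beta>\<^sub>y \<and> \<beta>\<^sub>y < 1 \<and>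
            \<beta>\<^sub>y \<le> B * real T powr (- (1 / 2)) \<and>
            (\<exists>t<T. game_stationary f X Y (C * real T powr (- (1 / 4)))
               (dsogda_x f X Y r\<^sub>x r\<^sub>y \<eta>\<^sub>x \<eta>\<^sub>y \<beta>\<^sub>x \<beta>\<^sub>y x\<^sub>0 y\<^sub>0 (t + 1))
               (dsogda_y f X Y r\<^sub>x r\<^sub>y \<eta>\<^sub>x \<eta>\<^sub>y \<beta>\<^sub>x \<beta>\<^sub>y x\<^sub>0 y\<^sub>0 (t + 1)))))) \<and>
     (\<forall>\<theta>::real. 0 < \<theta> \<and> \<theta> < 1 \<and> primal_KL f X Y \<theta> \<and> compact Y \<longrightarrow>
       (\<exists>K B C. \<forall>T::nat. T > 1 \<longrightarrow>
         (\<exists>r\<^sub>x r\<^sub>y \<eta>\<^sub>x \<eta>\<^sub>y \<beta>\<^sub>x \<beta>\<^sub>y.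
            0 < r\<^sub>x \<and> r\<^sub>x \<le> K \<and> 0 < r\<^sub>y \<and> r\<^sub>y \<le> K \<and>
            0 < \<eta>\<^sub>x \<and> \<eta>\<^sub>x \<le> K \<and> 0 < \<eta>\<^sub>y \<and> \<eta>\<^sub>y \<le> K \<and>
            0 < \<beta>\<^sub>x \<and> \<beta>\<^sub>x < 1 \<and> 0 < \<beta>\<^sub>y \<and> \<beta>\<^sub>y < 1 \<and>
            \<beta>\<^sub>y \<le> B * real T powr (- (max (2 * \<theta> - 1) 0 / (2 * \<theta>))) \<and>
            (\<exists>t<T. game_stationary f X Y
               (C * real T powr (- (1 / (max (4 * \<theta> - 2) 0 + 2))))
               (dsogda_x f X Y r\<^sub>x r\<^sub>y \<eta>\<^sub>x \<eta>\<^sub>y \<beta>\<^sub>x \<beta>\<^sub>y x\<^sub>0 y\<^sub>0 (t + 1))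
               (dsogda_y f X Y r\<^sub>x r\<^sub>y \<eta>\<^sub>x \<eta>\<^sub>y \<beta>\<^sub>x \<beta>\<^sub>y x\<^sub>0 y\<^sub>0 (t + 1))))))"
proof (intro conjI allI impI; elim conjE)
  assume conv: "\<forall>y\<in>Y. convex_on X (\<lambda>x. f x y)" and bdd: "bdd_above (min_x f X ` Y)"
  interpret smooth_minimax f X Y L
    by (rule smooth_minimaxI) (use assms bdd in auto)
  have KL: "f x y - min_x f X y \<le> diameter X * norm (grad_x f x y + n) powr 1"
    if "x \<in> X" "y \<in> Y" "n \<in> normal_cone X x" for x y n
    using convex_gap_le[of y x n] conv that by simp
  have exponents: "1 - 1 / 2 = (1 / 2 :: real)"
    by simp
  show "\<exists>K B C. \<forall>T::nat. T > 1 \<longrightarrow>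
         (\<exists>r\<^sub>x r\<^sub>y \<eta>\<^sub>x \<eta>\<^sub>y \<beta>\<^sub>x \<beta>\<^sub>y.
            0 < r\<^sub>x \<and> r\<^sub>x \<le> K \<and> 0 < r\<^sub>y \<and> r\<^sub>y \<le> K \<and>
            0 < \<eta>\<^sub>x \<and> \<eta>\<^sub>x \<le> K \<and> 0 < \<eta>\<^sub>y \<and> \<eta>\<^sub>y \<le> K \<and>
            0 < \<beta>\<^sub>x \<and> \<beta>\<^sub>x < 1 \<and> 0 < \<beta>\<^sub>y \<and> \<beta>\<^sub>y < 1 \<and>
            \<beta>\<^sub>y \<le> B * real T powr (- (1 / 2)) \<and>
            (\<exists>t<T. game_stationary f X Y (C * real T powr (- (1 / 4)))
               (dsogda_x f X Y r\<^sub>x r\<^sub>y \<eta>\<^sub>x \<eta>\<^sub>y \<beta>\<^sub>x \<beta>\<^sub>y x\<^sub>0 y\<^sub>0 (t + 1))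
               (dsogda_y f X Y r\<^sub>x r\<^sub>y \<eta>\<^sub>x \<eta>\<^sub>y \<beta>\<^sub>x \<beta>\<^sub>y x\<^sub>0 y\<^sub>0 (t + 1))))"
    by (rule dsogda_rate[where p = 1, unfolded exponents, OF _ _ _ _ KL]) (use assms in auto)
next
  fix \<theta> :: real
  assume \<theta>: "0 < \<theta>" "\<theta> < 1" and KL: "primal_KL f X Y \<theta>" and "compact Y"
  \<comment> \<open>Compactness of \<open>Y\<close> bounds \<open>f\<close> on the product, which
    yields both the upper bound on \<open>min_x f X\<close> and a uniform bound \<open>2 * B\<close>
    on the gap.\<close>
  have "continuous_on (X \<times> Y) (\<lambda>(x, y). f x y)"
    using assms(7) unfolding continuously_differentiable_def
    by (intro continuous_at_imp_continuous_on ballI) (auto intro: differentiable_imp_continuous_within)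
  then have "bounded ((\<lambda>(x, y). f x y) ` (X \<times> Y))"
    using assms(2) \<open>compact Y\<close>
    by (intro compact_imp_bounded compact_continuous_image compact_Times)
  then obtain B where "\<And>q. q \<in> (\<lambda>(x, y). f x y) ` (X \<times> Y) \<Longrightarrow> norm q \<le> B"
    unfolding bounded_iff by blast
  then have B: "f x y \<le> B" "- B \<le> f x y" if "x \<in> X" "y \<in> Y" for x y
    using that by (fastforce simp: abs_le_iff)+
  have "min_x f X y \<le> B" if "y \<in> Y" for y
  proof -
    have "min_x f X y \<le> f x\<^sub>0 y"
      unfolding min_x_def using B that assms(10) by (intro cINF_lower bdd_belowI2[of _ "- B"]) auto
    then show ?thesis
      using B[OF assms(10) that] by linarith
  qed
  then have "bdd_above (min_x f X ` Y)"
    by (rule bdd_aboveI2)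
  then interpret smooth_minimax f X Y L
    by (intro smooth_minimaxI) (use assms in auto)
  \<comment> \<open>For \<open>\<theta> \<ge> 1 / 2\<close> this is \<open>1 / \<theta>\<close>, so
    \<open>1 - p / 2 = (2 * \<theta> - 1) / (2 * \<theta>)\<close> and
    \<open>p / 4 = 1 / (4 * \<theta>)\<close>. For smaller \<open>\<theta>\<close> the cap 2 gives 0
    and 1/2, the values of the positive parts.\<close>
  define p where "p = min 2 (1 / \<theta>)"
  have p: "1 \<le> p" "p \<le> 2" "p * \<theta> \<le> 1"
    using \<theta> by (auto simp: p_def min_def field_simps)
  have exponents: "1 - p / 2 = max (2 * \<theta> - 1) 0 / (2 * \<theta>)" "p / 4 = 1 / (max (4 * \<theta> - 2) 0 + 2)"
    using \<theta> by (auto simp: p_def min_def max_def field_simps)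
  have gap: "f x y - min_x f X y \<le> 2 * B" if "x \<in> X" "y \<in> Y" for x y
  proof -
    have "- B \<le> min_x f X y"
      unfolding min_x_def using B that by (intro cINF_greatest assms(1)) auto
    then show ?thesis
      using B[OF that] by linarith
  qed
  obtain M where M: "\<And>x y n. x \<in> X \<Longrightarrow> y \<in> Y \<Longrightarrow> n \<in> normal_cone X x \<Longrightarrow>
      f x y - min_x f X y \<le> M * norm (grad_x f x y + n) powr p"
    by (rule KL_gap_le[OF KL \<theta>(1), of p "2 * B"]) (use p gap in auto)
  show "\<exists>K B C. \<forall>T::nat. T > 1 \<longrightarrow>
         (\<exists>r\<^sub>x r\<^sub>y \<eta>\<^sub>x \<eta>\<^sub>y \<beta>\<^sub>x \<beta>\<^sub>y.
            0 < r\<^sub>x \<and> r\<^sub>x \<le> K \<and> 0 < r\<^sub>y \<and> r\<^sub>y \<le> K \<and>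
            0 < \<eta>\<^sub>x \<and> \<eta>\<^sub>x \<le> K \<and> 0 < \<eta>\<^sub>y \<and> \<eta>\<^sub>y \<le> K \<and>
            0 < \<beta>\<^sub>x \<and> \<beta>\<^sub>x < 1 \<and> 0 < \<beta>\<^sub>y \<and> \<beta>\<^sub>y < 1 \<and>
            \<beta>\<^sub>y \<le> B * real T powr (- (max (2 * \<theta> - 1) 0 / (2 * \<theta>))) \<and>
            (\<exists>t<T. game_stationary f X Y
               (C * real T powr (- (1 / (max (4 * \<theta> - 2) 0 + 2))))
               (dsogda_x f X Y r\<^sub>x r\<^sub>y \<eta>\<^sub>x \<eta>\<^sub>y \<beta>\<^sub>x \<beta>\<^sub>y x\<^sub>0 y\<^sub>0 (t + 1))
               (dsogda_y f X Y r\<^sub>x r\<^sub>y \<eta>\<^sub>x \<eta>\<^sub>y \<beta>\<^sub>x \<beta>\<^sub>y x\<^sub>0 y\<^sub>0 (t + 1))))"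
    by (rule dsogda_rate[where p = p, unfolded exponents, OF _ _ _ _ M]) (use assms p in auto)
qed

end
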